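(* (1) Setwise-Disjoint Facility Location (SDFL) is at least as hard to approximate as Set Cover by Pairs (SCP). (2) Pathwise-Disjoint Facility Location (PDFL) is at least as hard to approximate as Set Cover.
   Context: An instance of SDFL or PDFL consists of an arc-weighted, strongly connected directed graph $G=(V,A)$ and sets $C\subseteq F\subseteq V$ (customers and potential facility locations). For $c\in C$, $f\in F$, $P(c,f)$ is the set of all shortest (minimum total arc weight) directed paths from $c$ to $f$. A pair $\{f_1,f_2\}\subseteq F\setminus\{c\}$ covers $c$ in a pathwise-disjoint fashion if there are $p_1\in P(c,f_1)$, $p_2\in P(c,f_2)$ with no common vertex except $c$; it covers $c$ in a setwise-disjoint fashion if no path in $P(c,f_1)$ shares a vertex other than $c$ with any path in $P(c,f_2)$. A set $F'\subseteq F$ is a pathwise-disjoint (resp. setwise-disjoint) cover if every $c\in C\setminus F'$ is covered in that fashion by some pair $\{f_1,f_2\}\subseteq F'\setminus\{c\}$ (customers in $F'$ cover themselves). PDFL (resp. SDFL) asks for a minimum-size pathwise-disjoint (resp. setwise-disjoint) cover. SCP: given a ground set $U$, a set $S$ of cover objects and a set $T\subseteq U\times S\times S$ of triples, find a minimum-size $S'\subseteq S$ such that for each $u\in U$ there are $s,t\in S'$ with $(u,s,t)\in T$. Set Cover: given a ground set $U$ and a collection of subsets of $U$ whose union is $U$, find a minimum-size subcollection whose union is $U$. "Problem A is at least as hard to approximate as problem B" means that there is a polynomial-time reduction from B to A under which a polynomial-time approximation guarantee for A yields an (essentially) equally good polynomial-time approximation guarantee for B. *)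

theory Defs
  imports
    "Graph_Theory.Graph_Theory"
    "HOL-Computational_Algebra.Polynomial"
begin

section \<open>The four covering notions\<close>

subsection \<open>Disjoint-path facility location\<close>

text \<open>
  Arcs are pairs of vertices, and a path is the list of its arcs.  Being an \<open>apath\<close>, a path does
  not repeat vertices.  The constant \<open>wf_digraph.awalk_cost\<close> does not depend on the graph.
\<close>

record 'a dfl_instance =
  graph :: "'a pair_pre_digraph"
  weight :: "'a \<times> 'a \<Rightarrow> real"
  customers :: "'a set"
  facilities :: "'a set"

definition dfl_valid :: "'a dfl_instance \<Rightarrow> bool" where
  "dfl_valid I \<longleftrightarrow>
     pair_fin_digraph (graph I) \<and>
     strongly_connected (with_proj (graph I)) \<and>
     (\<forall>a \<in> parcs (graph I). 0 \<le> weight I a) \<and>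
     customers I \<subseteq> facilities I \<and> facilities I \<subseteq> pverts (graph I)"

definition shortest_paths :: "'a dfl_instance \<Rightarrow> 'a \<Rightarrow> 'a \<Rightarrow> ('a \<times> 'a) awalk set" where
  "shortest_paths I c f =
     {p. pre_digraph.apath (with_proj (graph I)) c p f \<and>
         (\<forall>q. pre_digraph.apath (with_proj (graph I)) c q f \<longrightarrow>
              wf_digraph.awalk_cost (weight I) p \<le> wf_digraph.awalk_cost (weight I) q)}"

definition meet_only_at :: "'a dfl_instance \<Rightarrow> 'a \<Rightarrow> ('a \<times> 'a) awalk \<Rightarrow> ('a \<times> 'a) awalk \<Rightarrow> bool" where
  "meet_only_at I c p q \<longleftrightarrow>
     set (pre_digraph.awalk_verts (with_proj (graph I)) c p) \<inter>
     set (pre_digraph.awalk_verts (with_proj (graph I)) c q) \<subseteq> {c}"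

definition pathwise_covers :: "'a dfl_instance \<Rightarrow> 'a \<Rightarrow> 'a \<Rightarrow> 'a \<Rightarrow> bool" where
  "pathwise_covers I c f1 f2 \<longleftrightarrow>
     (\<exists>p \<in> shortest_paths I c f1. \<exists>q \<in> shortest_paths I c f2. meet_only_at I c p q)"

definition setwise_covers :: "'a dfl_instance \<Rightarrow> 'a \<Rightarrow> 'a \<Rightarrow> 'a \<Rightarrow> bool" where
  "setwise_covers I c f1 f2 \<longleftrightarrow>
     (\<forall>p \<in> shortest_paths I c f1. \<forall>q \<in> shortest_paths I c f2. meet_only_at I c p q)"

definition pathwise_disjoint_cover :: "'a dfl_instance \<Rightarrow> 'a set \<Rightarrow> bool" where
  "pathwise_disjoint_cover I F' \<longleftrightarrow> F' \<subseteq> facilities I \<and>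
     (\<forall>c \<in> customers I - F'. \<exists>f1 \<in> F' - {c}. \<exists>f2 \<in> F' - {c}.
        f1 \<noteq> f2 \<and> pathwise_covers I c f1 f2)"

definition setwise_disjoint_cover :: "'a dfl_instance \<Rightarrow> 'a set \<Rightarrow> bool" where
  "setwise_disjoint_cover I F' \<longleftrightarrow> F' \<subseteq> facilities I \<and>
     (\<forall>c \<in> customers I - F'. \<exists>f1 \<in> F' - {c}. \<exists>f2 \<in> F' - {c}.
        f1 \<noteq> f2 \<and> setwise_covers I c f1 f2)"

subsection \<open>Set Cover by Pairs and Set Cover\<close>

record ('u, 's) scp_instance =
  scp_ground :: "'u set"
  scp_objects :: "'s set"
  scp_triples :: "('u \<times> 's \<times> 's) set"

definition scp_valid :: "('u, 's) scp_instance \<Rightarrow> bool" where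
  "scp_valid I \<longleftrightarrow> finite (scp_ground I) \<and> finite (scp_objects I) \<and>
     scp_triples I \<subseteq> scp_ground I \<times> scp_objects I \<times> scp_objects I"

definition scp_cover :: "('u, 's) scp_instance \<Rightarrow> 's set \<Rightarrow> bool" where
  "scp_cover I S' \<longleftrightarrow> S' \<subseteq> scp_objects I \<and>
     (\<forall>u \<in> scp_ground I. \<exists>s \<in> S'. \<exists>t \<in> S'. (u, s, t) \<in> scp_triples I)"

record 'u sc_instance =
  sc_ground :: "'u set"
  sc_sets :: "'u set set"

definition sc_valid :: "'u sc_instance \<Rightarrow> bool" where
  "sc_valid I \<longleftrightarrow> finite (sc_ground I) \<and> \<Union> (sc_sets I) = sc_ground I"

definition sc_cover :: "'u sc_instance \<Rightarrow> 'u set set \<Rightarrow> bool" where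
  "sc_cover I X \<longleftrightarrow> X \<subseteq> sc_sets I \<and> \<Union> X = sc_ground I"

section \<open>Polynomial-time computation\<close>

text \<open>
  The machine model is the language of while programs over binary trees, with registers indexed by
  natural numbers.  Evaluating an expression is charged for copying every register it reads and for
  every operation it performs; hence the size of each computed tree is bounded by the charged time,
  and a Turing machine simulates a program with polynomial overhead (and conversely).
\<close>

datatype sexp = Null | Dot sexp sexp

datatype expr = Var nat | Nul | Pr expr expr | Fst expr | Snd expr | Equal expr expr

datatype com =
    Skip
  | Assign nat expr
  | Seq com com
  | Cond expr com com
  | While expr com

type_synonym state = "nat \<Rightarrow> sexp"

fun car :: "sexp \<Rightarrow> sexp" where
  "car Null = Null"
| "car (Dot a b) = a"

fun cdr :: "sexp \<Rightarrow> sexp" where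
  "cdr Null = Null"
| "cdr (Dot a b) = b"

fun val :: "expr \<Rightarrow> state \<Rightarrow> sexp" where
  "val (Var x) s = s x"
| "val Nul s = Null"
| "val (Pr a b) s = Dot (val a s) (val b s)"
| "val (Fst a) s = car (val a s)"
| "val (Snd a) s = cdr (val a s)"
| "val (Equal a b) s = (if val a s = val b s then Dot Null Null else Null)"

fun expr_time :: "expr \<Rightarrow> state \<Rightarrow> nat" where
  "expr_time (Var x) s = 1 + size (s x)"
| "expr_time Nul s = 1"
| "expr_time (Pr a b) s = 1 + expr_time a s + expr_time b s"
| "expr_time (Fst a) s = 1 + expr_time a s"
| "expr_time (Snd a) s = 1 + expr_time a s"
| "expr_time (Equal a b) s = 1 + expr_time a s + expr_time b s"

text \<open>\<open>exec c s t s'\<close>: started in state \<open>s\<close>, the program \<open>c\<close> halts after time \<open>t\<close> in state \<open>s'\<close>.\<close>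

inductive exec :: "com \<Rightarrow> state \<Rightarrow> nat \<Rightarrow> state \<Rightarrow> bool" where
  Skip: "exec Skip s 1 s"
| Assign: "exec (Assign x e) s (1 + expr_time e s) (s(x := val e s))"
| Seq: "exec c1 s t1 s1 \<Longrightarrow> exec c2 s1 t2 s2 \<Longrightarrow> exec (Seq c1 c2) s (t1 + t2) s2"
| CondTrue: "val b s \<noteq> Null \<Longrightarrow> exec c1 s t s' \<Longrightarrow>
    exec (Cond b c1 c2) s (1 + expr_time b s + t) s'"
| CondFalse: "val b s = Null \<Longrightarrow> exec c2 s t s' \<Longrightarrow>
    exec (Cond b c1 c2) s (1 + expr_time b s + t) s'"
| WhileFalse: "val b s = Null \<Longrightarrow> exec (While b c) s (1 + expr_time b s) s"
| WhileTrue: "val b s \<noteq> Null \<Longrightarrow> exec c s t1 s1 \<Longrightarrow> exec (While b c) s1 t2 s2 \<Longrightarrow>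
    exec (While b c) s (1 + expr_time b s + t1 + t2) s2"

text \<open>Register 0 holds the input at the start and the output at the end.\<close>

definition init :: "sexp \<Rightarrow> state" where
  "init d = (\<lambda>_. Null)(0 := d)"

definition polytime :: "(sexp \<Rightarrow> sexp) \<Rightarrow> bool" where
  "polytime f \<longleftrightarrow> (\<exists>c (p :: nat poly). \<forall>d. \<exists>t s.
     exec c (init d) t s \<and> s 0 = f d \<and> t \<le> poly p (size d))"

section \<open>Optimization problems and approximation-preserving reductions\<close>

text \<open>
  Minimization problems whose instances and solutions are written down as trees.  An object may
  have several codes, because a finite set may be listed in any order.
\<close>

record ('i, 's) min_problem =
  instances :: "'i set"
  solutions :: "'i \<Rightarrow> 's set"
  cost :: "'s \<Rightarrow> nat"
  instance_codes :: "'i \<Rightarrow> sexp set"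
  solution_codes :: "'s \<Rightarrow> sexp set"

definition optimum :: "('i, 's) min_problem \<Rightarrow> 'i \<Rightarrow> nat" where
  "optimum P I = Inf (cost P ` solutions P I)"

definition approximates :: "('i, 's) min_problem \<Rightarrow> real \<Rightarrow> 'i \<Rightarrow> 's \<Rightarrow> bool" where
  "approximates P r I x \<longleftrightarrow> x \<in> solutions P I \<and> real (cost P x) \<le> r * real (optimum P I)"

text \<open>
  The reduction is a pair: \<open>f\<close> maps instances of \<open>B\<close> to instances of \<open>A\<close>, and \<open>g\<close> maps an instance
  of \<open>B\<close> together with a solution of its image back to a solution, which is at least as good: every
  approximation ratio attained in \<open>A\<close> is attained in \<open>B\<close>.  Instances without any solution are
  outside the scope of approximation; a solvable instance must be mapped to a solvable one.
\<close>

definition at_least_as_hard_to_approximate ::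
    "('i, 's) min_problem \<Rightarrow> ('j, 't) min_problem \<Rightarrow> bool" where
  "at_least_as_hard_to_approximate A B \<longleftrightarrow>
     (\<exists>f g. polytime f \<and> polytime g \<and>
        (\<forall>I \<in> instances B. \<forall>d \<in> instance_codes B I. solutions B I \<noteq> {} \<longrightarrow>
           (\<exists>J \<in> instances A. f d \<in> instance_codes A J \<and> solutions A J \<noteq> {} \<and>
              (\<forall>y \<in> solutions A J. \<forall>e \<in> solution_codes A y.
                 \<exists>x \<in> solutions B I. g (Dot d e) \<in> solution_codes B x \<and>
                   (\<forall>r \<ge> 1. approximates A r J y \<longrightarrow> approximates B r I x)))))"

text \<open>A guarantee is a function of the length of the coded instance.\<close>

definition has_polytime_approximation ::
    "('i, 's) min_problem \<Rightarrow> (nat \<Rightarrow> real) \<Rightarrow> bool" where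
  "has_polytime_approximation P r \<longleftrightarrow>
     (\<exists>a. polytime a \<and>
        (\<forall>I \<in> instances P. \<forall>d \<in> instance_codes P I. solutions P I \<noteq> {} \<longrightarrow>
           (\<exists>x. a d \<in> solution_codes P x \<and> approximates P (r (size d)) I x)))"

section \<open>Transfer of polynomial-time approximation guarantees\<close>

fun expr_vars :: "expr \<Rightarrow> nat set" where
  "expr_vars (Var x) = {x}"
| "expr_vars Nul = {}"
| "expr_vars (Pr a b) = expr_vars a \<union> expr_vars b"
| "expr_vars (Fst a) = expr_vars a"
| "expr_vars (Snd a) = expr_vars a"
| "expr_vars (Equal a b) = expr_vars a \<union> expr_vars b"

fun com_vars :: "com \<Rightarrow> nat set" where
  "com_vars Skip = {}"
| "com_vars (Assign x e) = insert x (expr_vars e)"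
| "com_vars (Seq c1 c2) = com_vars c1 \<union> com_vars c2"
| "com_vars (Cond b c1 c2) = expr_vars b \<union> com_vars c1 \<union> com_vars c2"
| "com_vars (While b c) = expr_vars b \<union> com_vars c"

lemma finite_expr_vars: "finite (expr_vars e)"
  by (induction e) auto

lemma finite_com_vars: "finite (com_vars c)"
  by (induction c) (auto simp: finite_expr_vars)

lemma size_car: "size (car d) \<le> size d" and size_cdr: "size (cdr d) \<le> size d"
  by (cases d; simp)+

lemma size_val: "size (val e s) \<le> expr_time e s"
proof (induction e)
  case (Fst e) then show ?case using size_car[of "val e s"] by simp
next
  case (Snd e) then show ?case using size_cdr[of "val e s"] by simp
qed auto

lemma exec_size: "exec c s t s' \<Longrightarrow> size (s' x) \<le> size (s x) + t"
proof (induction rule: exec.induct)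
  case (Assign y e s) then show ?case using size_val[of e s] by simp
qed auto

lemma expr_agree:
  "(\<And>x. x \<in> expr_vars e \<Longrightarrow> s x = z x) \<Longrightarrow> val e s = val e z \<and> expr_time e s = expr_time e z"
  by (induction e) auto

lemma exec_frame: "exec c s t s' \<Longrightarrow> x \<notin> com_vars c \<Longrightarrow> s' x = s x"
  by (induction rule: exec.induct) auto

lemma exec_agree:
  assumes "exec c s t s'" "com_vars c \<subseteq> X" "\<And>x. x \<in> X \<Longrightarrow> s x = z x"
  shows "\<exists>z'. exec c z t z' \<and> (\<forall>x \<in> X. s' x = z' x)"
  using assms
proof (induction arbitrary: z rule: exec.induct)
  case (Skip s) then show ?case using exec.Skip by blast
next
  case (Assign x e s)
  have "val e s = val e z \<and> expr_time e s = expr_time e z"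
    using Assign by (intro expr_agree) auto
  with exec.Assign[of x e z] Assign.prems(2)
  have "exec (Assign x e) z (1 + expr_time e s) (z(x := val e z)) \<and>
      (\<forall>y \<in> X. (s(x := val e s)) y = (z(x := val e z)) y)" by simp
  then show ?case by blast
next
  case (Seq c1 s t1 s1 c2 t2 s2)
  from Seq.prems have X: "com_vars c1 \<subseteq> X" "com_vars c2 \<subseteq> X" by auto
  obtain z1 where z1: "exec c1 z t1 z1" "\<forall>x \<in> X. s1 x = z1 x"
    using Seq.IH(1)[OF X(1) Seq.prems(2)] by blast
  obtain z2 where "exec c2 z1 t2 z2" "\<forall>x \<in> X. s2 x = z2 x"
    using Seq.IH(2)[OF X(2), of z1] z1(2) by blast
  with z1 exec.Seq show ?case by blast
next
  case (CondTrue b s c1 t s' c2)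
  from CondTrue.prems have X: "com_vars c1 \<subseteq> X" by auto
  have e: "val b s = val b z \<and> expr_time b s = expr_time b z"
    using CondTrue.prems by (intro expr_agree) auto
  obtain z' where "exec c1 z t z'" "\<forall>x \<in> X. s' x = z' x"
    using CondTrue.IH[OF X CondTrue.prems(2)] by blast
  with e CondTrue.hyps exec.CondTrue[of b z c1 t z' c2] show ?case by auto
next
  case (CondFalse b s c2 t s' c1)
  from CondFalse.prems have X: "com_vars c2 \<subseteq> X" by auto
  have e: "val b s = val b z \<and> expr_time b s = expr_time b z"
    using CondFalse.prems by (intro expr_agree) auto
  obtain z' where "exec c2 z t z'" "\<forall>x \<in> X. s' x = z' x"
    using CondFalse.IH[OF X CondFalse.prems(2)] by blast
  with e CondFalse.hyps exec.CondFalse[of b z c2 t z' c1] show ?case by auto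
next
  case (WhileFalse b s c)
  have e: "val b s = val b z \<and> expr_time b s = expr_time b z"
    using WhileFalse.prems by (intro expr_agree) auto
  with WhileFalse exec.WhileFalse[of b z c] show ?case by auto
next
  case (WhileTrue b s c t1 s1 t2 s2)
  from WhileTrue.prems have X: "com_vars c \<subseteq> X" by auto
  have e: "val b s = val b z \<and> expr_time b s = expr_time b z"
    using WhileTrue.prems by (intro expr_agree) auto
  obtain z1 where z1: "exec c z t1 z1" "\<forall>x \<in> X. s1 x = z1 x"
    using WhileTrue.IH(1)[OF X WhileTrue.prems(2)] by blast
  obtain z2 where z2: "exec (While b c) z1 t2 z2" "\<forall>x \<in> X. s2 x = z2 x"
    using WhileTrue.IH(2)[OF WhileTrue.prems(1), of z1] z1(2) by blast
  with e z1 WhileTrue.hyps exec.WhileTrue[of b z c t1 z1 t2 z2] show ?case by auto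
qed

primrec clear :: "nat \<Rightarrow> com" where
  "clear 0 = Skip"
| "clear (Suc n) = Seq (clear n) (Assign (Suc n) Nul)"

lemma exec_clear: "exec (clear n) s (1 + 2 * n) (\<lambda>x. if 1 \<le> x \<and> x \<le> n then Null else s x)"
proof (induction n)
  case 0
  have "(\<lambda>x. if 1 \<le> x \<and> x \<le> (0::nat) then Null else s x) = s" by auto
  then show ?case using exec.Skip[of s] by simp
next
  case (Suc n)
  let ?s = "\<lambda>x. if 1 \<le> x \<and> x \<le> n then Null else s x"
  have "(\<lambda>x. if 1 \<le> x \<and> x \<le> Suc n then Null else s x) = ?s(Suc n := val Nul ?s)"
    by (auto simp: fun_eq_iff)
  with exec.Seq[OF Suc exec.Assign[of "Suc n" Nul ?s]] show ?case by (simp add: add.commute)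
qed

lemma poly_nat_mono: "mono (poly (p :: nat poly))"
proof (rule monoI)
  fix x y :: nat assume "x \<le> y"
  then show "poly p x \<le> poly p y"
    by (induction p) (auto intro: mult_le_mono)
qed

lemma polytimeE:
  assumes "polytime f"
  obtains c p where "\<And>d. \<exists>t s. exec c (init d) t s \<and> s 0 = f d \<and> t \<le> poly (p :: nat poly) (size d)"
  using assms unfolding polytime_def by blast

lemma polytime_size:
  assumes "polytime f"
  obtains p where "\<And>d. size (f d) \<le> poly (p :: nat poly) (size d)"
proof -
  obtain c and p :: "nat poly"
    where c: "\<And>d. \<exists>t s. exec c (init d) t s \<and> s 0 = f d \<and> t \<le> poly p (size d)"
    using polytimeE[OF assms] by blast
  have "size (f d) \<le> poly ([:0, 1:] + p) (size d)" for d
  proof -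
    obtain t s where "exec c (init d) t s" "s 0 = f d" "t \<le> poly p (size d)" using c by blast
    then show ?thesis using exec_size[of c "init d" t s 0] by (simp add: init_def)
  qed
  with that show thesis by blast
qed

lemma polytime_comp:
  assumes "polytime f" "polytime g"
  shows "polytime (\<lambda>d. g (f d))"
proof -
  obtain c and p :: "nat poly"
    where c: "\<And>d. \<exists>t s. exec c (init d) t s \<and> s 0 = f d \<and> t \<le> poly p (size d)"
    using polytimeE[OF assms(1)] by blast
  obtain c' and p' :: "nat poly"
    where c': "\<And>d. \<exists>t s. exec c' (init d) t s \<and> s 0 = g d \<and> t \<le> poly p' (size d)"
    using polytimeE[OF assms(2)] by blast
  obtain q :: "nat poly" where q: "\<And>d. size (f d) \<le> poly q (size d)"
    using polytime_size[OF assms(1)] by blast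
  obtain n where n: "\<And>x. x \<in> com_vars c \<Longrightarrow> x \<le> n"
    using finite_com_vars[of c] finite_nat_set_iff_bounded_le by auto
  have "\<exists>t s. exec (Seq c (Seq (clear n) c')) (init d) t s \<and> s 0 = g (f d) \<and>
          t \<le> poly (p + [:1 + 2 * n:] + pcompose p' q) (size d)" for d
  proof -
    obtain t s where s: "exec c (init d) t s" "s 0 = f d" "t \<le> poly p (size d)" using c by blast
    obtain t' s' where s': "exec c' (init (f d)) t' s'" "s' 0 = g (f d)" "t' \<le> poly p' (size (f d))"
      using c' by blast
    have "(\<lambda>x. if 1 \<le> x \<and> x \<le> n then Null else s x) = init (f d)"
    proof
      fix x
      have "s x = init d x" if "\<not> x \<le> n" using exec_frame[OF s(1)] n that by blast
      then show "(if 1 \<le> x \<and> x \<le> n then Null else s x) = init (f d) x"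
        using s(2) by (auto simp: init_def)
    qed
    then have "exec (clear n) s (1 + 2 * n) (init (f d))" using exec_clear[of n s] by simp
    from exec.Seq[OF s(1) exec.Seq[OF this s'(1)]]
    have "exec (Seq c (Seq (clear n) c')) (init d) (t + (1 + 2 * n + t')) s'" .
    moreover have "t' \<le> poly p' (poly q (size d))"
      using s'(3) monoD[OF poly_nat_mono q] by (rule le_trans)
    ultimately show ?thesis using s(3) s'(2)
      by (intro exI[of _ "t + (1 + 2 * n + t')"] exI[of _ s']) (auto simp: poly_pcompose)
  qed
  then show ?thesis unfolding polytime_def by blast
qed

lemma polytime_Dot:
  assumes "polytime f"
  shows "polytime (\<lambda>d. Dot d (f d))"
proof -
  obtain c and p :: "nat poly"
    where c: "\<And>d. \<exists>t s. exec c (init d) t s \<and> s 0 = f d \<and> t \<le> poly p (size d)"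
    using polytimeE[OF assms] by blast
  obtain q :: "nat poly" where q: "\<And>d. size (f d) \<le> poly q (size d)"
    using polytime_size[OF assms] by blast
  obtain n where n: "\<And>x. x \<in> com_vars c \<Longrightarrow> x < n" "0 < n"
  proof -
    obtain m where "\<forall>x \<in> com_vars c. x \<le> m"
      using finite_com_vars[of c] finite_nat_set_iff_bounded_le by auto
    then show thesis by (intro that[of "Suc m"]) auto
  qed
  let ?p = "Seq (Assign n (Var 0)) (Seq c (Assign 0 (Pr (Var n) (Var 0))))"
  have "\<exists>t s. exec ?p (init d) t s \<and> s 0 = Dot d (f d) \<and>
          t \<le> poly ([:6, 2:] + p + q) (size d)" for d
  proof -
    obtain t s where s: "exec c (init d) t s" "s 0 = f d" "t \<le> poly p (size d)" using c by blast
    have a: "exec (Assign n (Var 0)) (init d) (2 + size d) ((init d)(n := d))"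
      using exec.Assign[of n "Var 0" "init d"] by (simp add: init_def)
    have "com_vars c \<subseteq> {..<n}" using n by auto
    from exec_agree[OF s(1) this, of "(init d)(n := d)"] n(2)
    obtain z where z: "exec c ((init d)(n := d)) t z" "z 0 = f d" using s(2) by auto
    have zn: "z n = d" using exec_frame[OF z(1), of n] n(1)[of n] by auto
    have b: "exec (Assign 0 (Pr (Var n) (Var 0))) z (4 + size d + size (f d)) (z(0 := Dot d (f d)))"
      using exec.Assign[of 0 "Pr (Var n) (Var 0)" z] zn z(2) by (simp add: eval_nat_numeral)
    let ?t = "2 + size d + (t + (4 + size d + size (f d)))"
    have "exec ?p (init d) ?t (z(0 := Dot d (f d)))"
      using exec.Seq[OF a exec.Seq[OF z(1) b]] .
    moreover have "?t \<le> poly ([:6, 2:] + p + q) (size d)" using s(3) q[of d] by simp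
    moreover have "(z(0 := Dot d (f d))) 0 = Dot d (f d)" by simp
    ultimately show ?thesis by blast
  qed
  then show ?thesis unfolding polytime_def by blast
qed

text \<open>
  The guarantee carries over with the same ratio, evaluated at the length of the constructed
  instance, which is polynomial in the length of the given one.
\<close>

theorem approximation_transfer:
  assumes "at_least_as_hard_to_approximate A B"
    and "has_polytime_approximation A r" and "mono r" and "\<And>n. 1 \<le> r n"
  shows "\<exists>p :: nat poly. has_polytime_approximation B (\<lambda>n. r (poly p n))"
proof -
  obtain f g where f: "polytime f" and g: "polytime g" and red:
    "\<And>I d. I \<in> instances B \<Longrightarrow> d \<in> instance_codes B I \<Longrightarrow> solutions B I \<noteq> {} \<Longrightarrow>
       \<exists>J \<in> instances A. f d \<in> instance_codes A J \<and> solutions A J \<noteq> {} \<and>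
         (\<forall>y \<in> solutions A J. \<forall>e \<in> solution_codes A y.
            \<exists>x \<in> solutions B I. g (Dot d e) \<in> solution_codes B x \<and>
              (\<forall>r \<ge> 1. approximates A r J y \<longrightarrow> approximates B r I x))"
    using assms(1) unfolding at_least_as_hard_to_approximate_def by metis
  obtain a where a: "polytime a" and app:
    "\<And>I d. I \<in> instances A \<Longrightarrow> d \<in> instance_codes A I \<Longrightarrow> solutions A I \<noteq> {} \<Longrightarrow>
       \<exists>x. a d \<in> solution_codes A x \<and> approximates A (r (size d)) I x"
    using assms(2) unfolding has_polytime_approximation_def by metis
  obtain p :: "nat poly" where p: "\<And>d. size (f d) \<le> poly p (size d)"
    using polytime_size[OF f] by blast
  have "polytime (\<lambda>d. g (Dot d (a (f d))))"
    using polytime_comp[OF polytime_Dot[OF polytime_comp[OF f a]] g] .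
  moreover have "\<exists>x. g (Dot d (a (f d))) \<in> solution_codes B x \<and>
      approximates B (r (poly p (size d))) I x"
    if I: "I \<in> instances B" "d \<in> instance_codes B I" "solutions B I \<noteq> {}" for I d
  proof -
    obtain J where J: "J \<in> instances A" "f d \<in> instance_codes A J" "solutions A J \<noteq> {}"
      and lift: "\<forall>y \<in> solutions A J. \<forall>e \<in> solution_codes A y.
         \<exists>x \<in> solutions B I. g (Dot d e) \<in> solution_codes B x \<and>
           (\<forall>r \<ge> 1. approximates A r J y \<longrightarrow> approximates B r I x)"
      using red[OF I] by blast
    obtain y where y: "a (f d) \<in> solution_codes A y" "approximates A (r (size (f d))) J y"
      using app[OF J] by blast
    then obtain x where x: "g (Dot d (a (f d))) \<in> solution_codes B x"
        "approximates B (r (size (f d))) I x"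
      using lift assms(4) unfolding approximates_def by blast
    have "r (size (f d)) \<le> r (poly p (size d))" using monoD[OF assms(3) p] .
    then have "r (size (f d)) * real (optimum B I) \<le> r (poly p (size d)) * real (optimum B I)"
      by (intro mult_right_mono) auto
    with x show ?thesis unfolding approximates_def by force
  qed
  ultimately show ?thesis unfolding has_polytime_approximation_def by blast
qed

section \<open>Codes\<close>

text \<open>
  Identifiers (vertices, ground elements, cover objects) are arbitrary trees.  Natural numbers are
  coded in binary, least significant bit first.  A finite set is coded by any repetition-free
  listing of its elements, where \<open>K x\<close> is the set of admissible codes of the element \<open>x\<close>.
\<close>

fun nat_code :: "nat \<Rightarrow> sexp" where
  "nat_code n =
     (if n = 0 then Null
      else Dot (if odd n then Dot Null Null else Null) (nat_code (n div 2)))"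

declare nat_code.simps [simp del]

definition nonneg_rat_code :: "rat \<Rightarrow> sexp" where
  "nonneg_rat_code q = Dot (nat_code (nat (fst (quotient_of q)))) (nat_code (nat (snd (quotient_of q))))"

fun list_code :: "sexp list \<Rightarrow> sexp" where
  "list_code [] = Null"
| "list_code (d # ds) = Dot d (list_code ds)"

definition set_codes :: "('a \<Rightarrow> sexp set) \<Rightarrow> 'a set \<Rightarrow> sexp set" where
  "set_codes K A =
     {list_code ds | ds xs. distinct xs \<and> set xs = A \<and> list_all2 (\<lambda>x d. d \<in> K x) xs ds}"

definition id_codes :: "sexp \<Rightarrow> sexp set" where
  "id_codes x = {x}"

definition arc_codes :: "(sexp \<times> sexp \<Rightarrow> real) \<Rightarrow> sexp \<times> sexp \<Rightarrow> sexp set" where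
  "arc_codes w a = {Dot (fst a) (Dot (snd a) (nonneg_rat_code q)) | q. w a = real_of_rat q}"

definition triple_codes :: "sexp \<times> sexp \<times> sexp \<Rightarrow> sexp set" where
  "triple_codes = (\<lambda>(u, s, t). {Dot u (Dot s t)})"

definition dfl_codes :: "sexp dfl_instance \<Rightarrow> sexp set" where
  "dfl_codes I =
     {Dot v (Dot a (Dot c f)) | v a c f.
        v \<in> set_codes id_codes (pverts (graph I)) \<and>
        a \<in> set_codes (arc_codes (weight I)) (parcs (graph I)) \<and>
        c \<in> set_codes id_codes (customers I) \<and>
        f \<in> set_codes id_codes (facilities I)}"

definition scp_codes :: "(sexp, sexp) scp_instance \<Rightarrow> sexp set" where
  "scp_codes I =
     {Dot u (Dot s t) | u s t.
        u \<in> set_codes id_codes (scp_ground I) \<and>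
        s \<in> set_codes id_codes (scp_objects I) \<and>
        t \<in> set_codes triple_codes (scp_triples I)}"

definition sc_codes :: "sexp sc_instance \<Rightarrow> sexp set" where
  "sc_codes I =
     {Dot u s | u s.
        u \<in> set_codes id_codes (sc_ground I) \<and>
        s \<in> set_codes (set_codes id_codes) (sc_sets I)}"

section \<open>The four optimization problems\<close>

definition PDFL :: "(sexp dfl_instance, sexp set) min_problem" where
  "PDFL = \<lparr> instances = {I. dfl_valid I},
            solutions = (\<lambda>I. {F'. pathwise_disjoint_cover I F'}),
            cost = card,
            instance_codes = dfl_codes,
            solution_codes = set_codes id_codes \<rparr>"

definition SDFL :: "(sexp dfl_instance, sexp set) min_problem" where
  "SDFL = \<lparr> instances = {I. dfl_valid I},
            solutions = (\<lambda>I. {F'. setwise_disjoint_cover I F'}),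
            cost = card,
            instance_codes = dfl_codes,
            solution_codes = set_codes id_codes \<rparr>"

definition SCP :: "((sexp, sexp) scp_instance, sexp set) min_problem" where
  "SCP = \<lparr> instances = {I. scp_valid I},
           solutions = (\<lambda>I. {S'. scp_cover I S'}),
           cost = card,
           instance_codes = scp_codes,
           solution_codes = set_codes id_codes \<rparr>"

definition Set_Cover :: "(sexp sc_instance, sexp set set) min_problem" where
  "Set_Cover = \<lparr> instances = {I. sc_valid I},
                 solutions = (\<lambda>I. {X. sc_cover I X}),
                 cost = card,
                 instance_codes = sc_codes,
                 solution_codes = set_codes (set_codes id_codes) \<rparr>"

end

theory Submission
  imports Defs
begin

text \<open>
  The required notion of reduction admits no additive loss, so the usual construction with one extra
  facility shared by all customers is too weak.  Instead the cover objects are taken in two copies,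
  and the facilities of either copy alone must solve the given instance: a solution of cost \<open>m\<close>
  yields a facility cover of size \<open>2 m\<close>, and the cheaper half of a facility cover of size \<open>n\<close> yields
  a solution of cost at most \<open>n / 2\<close>.  All ratios are then preserved exactly.

  Customers may serve as facilities and cover themselves.  To make this useless, a ground element \<open>u\<close>
  is represented in each copy by one customer for every object \<open>k\<close>, and choosing that customer is
  charged as choosing \<open>k\<close>: if all customers for \<open>u\<close> are chosen, then all objects have been paid for.

  Customers and objects are connected through a hub.  An object that covers \<open>u\<close> alone is joined to the
  customers of \<open>u\<close> by a direct arc of weight \<open>0\<close>, so it forms a disjoint pair with every other facility,
  while the shortest paths to all facilities that do not help \<open>u\<close> meet in the hub.  For SDFL, each pair of
  objects that fails to cover \<open>u\<close> gets a private intermediate vertex on shortest paths to both objects.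
\<close>

section \<open>Polynomial-time programs\<close>

definition pbound :: "(sexp \<Rightarrow> nat) \<Rightarrow> bool" where
  "pbound F \<longleftrightarrow> (\<exists>p :: nat poly. \<forall>d. F d \<le> poly p (size d))"

lemma pbound_const: "pbound (\<lambda>_. k)"
  unfolding pbound_def by (rule exI[of _ "[:k:]"]) simp

lemma pbound_arg: "pbound size"
  unfolding pbound_def by (rule exI[of _ "[:0, 1:]"]) simp

lemma pbound_add: "pbound F \<Longrightarrow> pbound G \<Longrightarrow> pbound (\<lambda>d. F d + G d)"
  unfolding pbound_def by (metis add_mono poly_add)

lemma pbound_mult: "pbound F \<Longrightarrow> pbound G \<Longrightarrow> pbound (\<lambda>d. F d * G d)"
  unfolding pbound_def by (metis mult_le_mono poly_mult)

lemma pbound_poly: "pbound F \<Longrightarrow> pbound (\<lambda>d. poly (p :: nat poly) (F d))"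
  unfolding pbound_def by (metis poly_pcompose monoD[OF poly_nat_mono])

lemma pbound_size: "polytime f \<Longrightarrow> pbound (\<lambda>d. size (f d))"
  unfolding pbound_def by (metis polytime_size)

lemmas pbound_intros = pbound_const pbound_arg pbound_add pbound_mult pbound_poly pbound_size

text \<open>Time bounds may thus mention the sizes of intermediate results; \<open>pbound\<close>
  then supplies a polynomial in the input size.\<close>

lemma polytimeI:
  assumes "\<And>d. \<exists>t s. exec c (init d) t s \<and> s 0 = f d \<and> t \<le> F d" "pbound F"
  shows "polytime f"
  using assms unfolding polytime_def pbound_def by (meson le_trans)

lemma exec_within:
  "exec c s t s' \<Longrightarrow> s' 0 = r \<Longrightarrow> t \<le> T \<Longrightarrow> \<exists>t s'. exec c s t s' \<and> s' 0 = r \<and> t \<le> T"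
  by blast

lemma exec_AssignI:
  "t = 1 + expr_time e s \<Longrightarrow> s' = s(x := val e s) \<Longrightarrow> exec (Assign x e) s t s'"
  using exec.Assign by simp

text \<open>Initially only register 0 can hold more than \<open>Null\<close>, so each read costs at
  most \<open>1 + size d\<close>; \<open>k\<close> depends on the expression alone.\<close>

lemma expr_time_linear: "\<exists>k. \<forall>d. expr_time e (init d) \<le> k * (1 + size d)"
proof (induction e)
  case (Var x)
  show ?case by (rule exI[of _ 1]) (simp add: init_def)
next
  case Nul
  show ?case by (rule exI[of _ 1]) simp
next
  case (Pr a b)
  then obtain k l where "\<forall>d. expr_time a (init d) \<le> k * (1 + size d)"
    "\<forall>d. expr_time b (init d) \<le> l * (1 + size d)" by blast
  then have "expr_time (Pr a b) (init d) \<le> (1 + k + l) * (1 + size d)" for d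
    using add_mono[of "expr_time a (init d)" "k * (1 + size d)" "expr_time b (init d)" "l * (1 + size d)"]
    by (simp add: algebra_simps)
  then show ?case by blast
next
  case (Fst a)
  then obtain k where "\<forall>d. expr_time a (init d) \<le> k * (1 + size d)" by blast
  then have "expr_time (Fst a) (init d) \<le> (1 + k) * (1 + size d)" for d
    using add_mono[of 1 "1 + size d" "expr_time a (init d)" "k * (1 + size d)"] by simp
  then show ?case by blast
next
  case (Snd a)
  then obtain k where "\<forall>d. expr_time a (init d) \<le> k * (1 + size d)" by blast
  then have "expr_time (Snd a) (init d) \<le> (1 + k) * (1 + size d)" for d
    using add_mono[of 1 "1 + size d" "expr_time a (init d)" "k * (1 + size d)"] by simp
  then show ?case by blast
next
  case (Equal a b)
  then obtain k l where "\<forall>d. expr_time a (init d) \<le> k * (1 + size d)"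
    "\<forall>d. expr_time b (init d) \<le> l * (1 + size d)" by blast
  then have "expr_time (Equal a b) (init d) \<le> (1 + k + l) * (1 + size d)" for d
    using add_mono[of "expr_time a (init d)" "k * (1 + size d)" "expr_time b (init d)" "l * (1 + size d)"]
    by (simp add: algebra_simps)
  then show ?case by blast
qed

lemma polytime_val: "polytime (\<lambda>d. val e (init d))"
proof -
  obtain k where k: "\<forall>d. expr_time e (init d) \<le> k * (1 + size d)"
    using expr_time_linear by blast
  show ?thesis
  proof (rule polytimeI)
    show "\<exists>t s. exec (Assign 0 e) (init d) t s \<and> s 0 = val e (init d) \<and> t \<le> 1 + k * (1 + size d)" for d
      using k by (intro exec_within[OF exec.Assign]) auto
  qed (intro pbound_intros)
qed

lemma polytime_id: "polytime (\<lambda>d. d)"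
  using polytime_val[of "Var 0"] by (simp add: init_def)

lemma polytime_const: "polytime (\<lambda>_. k)"
proof -
  have "\<exists>e. \<forall>s. val e s = k" for k
  proof (induction k)
    case Null
    show ?case by (rule exI[of _ Nul]) simp
  next
    case (Dot a b)
    then show ?case by (metis val.simps(3))
  qed
  then obtain e where "\<forall>s. val e s = k" by blast
  with polytime_val[of e] show ?thesis by simp
qed

lemma polytime_car: "polytime f \<Longrightarrow> polytime (\<lambda>d. car (f d))"
  using polytime_comp[of f car] polytime_val[of "Fst (Var 0)"] by (simp add: init_def)

lemma polytime_cdr: "polytime f \<Longrightarrow> polytime (\<lambda>d. cdr (f d))"
  using polytime_comp[of f cdr] polytime_val[of "Snd (Var 0)"] by (simp add: init_def)

text \<open>\<open>polytime_Dot\<close> keeps only the input next to a result. It is therefore used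
  twice, for \<open>f\<close> and then for \<open>g\<close> on the kept input, which is dropped at
  the end.\<close>

lemma polytime_pair:
  assumes "polytime f" "polytime g"
  shows "polytime (\<lambda>d. Dot (f d) (g d))"
proof -
  have "polytime (\<lambda>x. Dot x (g (car x)))"
    by (intro polytime_Dot polytime_comp[OF _ assms(2)] polytime_car polytime_id)
  moreover have "polytime (\<lambda>y. Dot (cdr (car y)) (cdr y))"
    using polytime_val[of "Pr (Snd (Fst (Var 0))) (Snd (Var 0))"] by (simp add: init_def)
  ultimately have "polytime (\<lambda>x. Dot (cdr x) (g (car x)))"
    using polytime_comp[of "\<lambda>x. Dot x (g (car x))" "\<lambda>y. Dot (cdr (car y)) (cdr y)"] by simp
  from polytime_comp[OF polytime_Dot[OF assms(1)] this] show ?thesis by simp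
qed

abbreviation truth :: "bool \<Rightarrow> sexp" where
  "truth P \<equiv> (if P then Dot Null Null else Null)"

definition polytime_pred :: "(sexp \<Rightarrow> bool) \<Rightarrow> bool" where
  "polytime_pred P \<longleftrightarrow> polytime (\<lambda>d. truth (P d))"

text \<open>Both branches are evaluated first, each in polynomial time on every input; the
  conditional merely selects one of the two finished results.\<close>

lemma polytime_if:
  assumes "polytime_pred P" "polytime f" "polytime g"
  shows "polytime (\<lambda>d. if P d then f d else g d)"
proof -
  let ?c = "Cond (Fst (Var 0)) (Assign 0 (Fst (Snd (Var 0)))) (Assign 0 (Snd (Snd (Var 0))))"
  let ?h = "\<lambda>d. if car d \<noteq> Null then car (cdr d) else cdr (cdr d)"
  have "polytime ?h"
  proof (rule polytimeI)
    fix d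
    show "\<exists>t s. exec ?c (init d) t s \<and> s 0 = ?h d \<and> t \<le> 8 + 2 * size d"
    proof (cases "car d = Null")
      case True
      then have "val (Fst (Var 0)) (init d) = Null" by (simp add: init_def)
      from exec_within[OF exec.CondFalse[OF this exec.Assign]] True show ?thesis
        by (simp add: init_def)
    next
      case False
      then have "val (Fst (Var 0)) (init d) \<noteq> Null" by (simp add: init_def)
      from exec_within[OF exec.CondTrue[OF this exec.Assign]] False show ?thesis
        by (simp add: init_def)
    qed
  qed (intro pbound_intros)
  moreover have "polytime (\<lambda>d. Dot (truth (P d)) (Dot (f d) (g d)))"
    using assms by (intro polytime_pair) (auto simp: polytime_pred_def)
  ultimately have "polytime (\<lambda>d. ?h (Dot (truth (P d)) (Dot (f d) (g d))))"
    by (rule polytime_comp[rotated])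
  moreover have "?h (Dot (truth (P d)) (Dot (f d) (g d))) = (if P d then f d else g d)" for d
    by simp
  ultimately show ?thesis by (simp only:)
qed

lemma polytime_pred_eq: "polytime f \<Longrightarrow> polytime g \<Longrightarrow> polytime_pred (\<lambda>d. f d = g d)"
  using polytime_comp[OF polytime_pair[of f g] polytime_val[of "Equal (Fst (Var 0)) (Snd (Var 0))"]]
  by (simp add: polytime_pred_def init_def)

lemma polytime_pred_if:
  assumes "polytime_pred P" "polytime_pred Q" "polytime_pred R"
  shows "polytime_pred (\<lambda>d. if P d then Q d else R d)"
proof -
  have "(\<lambda>d. truth (if P d then Q d else R d)) = (\<lambda>d. if P d then truth (Q d) else truth (R d))"
    by auto
  with polytime_if[OF assms(1), of "\<lambda>d. truth (Q d)" "\<lambda>d. truth (R d)"] assms(2,3) show ?thesis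
    by (simp add: polytime_pred_def)
qed

lemma polytime_pred_const: "polytime_pred (\<lambda>_. b)"
  unfolding polytime_pred_def by (rule polytime_const)

lemma polytime_pred_not: "polytime_pred P \<Longrightarrow> polytime_pred (\<lambda>d. \<not> P d)"
  using polytime_pred_if[of P "\<lambda>_. False" "\<lambda>_. True"] polytime_pred_const
  unfolding if_bool_eq_conj by simp

lemma polytime_pred_conj:
  assumes "polytime_pred P" "polytime_pred Q"
  shows "polytime_pred (\<lambda>d. P d \<and> Q d)"
proof -
  have "(\<lambda>d. P d \<and> Q d) = (\<lambda>d. if P d then Q d else False)" by auto
  then show ?thesis using polytime_pred_if[OF assms polytime_pred_const[of False]] by (simp only:)
qed

text \<open>The work registers are cleared first, so the program may be run from any state.\<close>

lemma polytime_subroutine: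
  assumes "polytime f"
  obtains c N and p :: "nat poly" where
    "\<And>s. \<exists>t s'. exec c s t s' \<and> s' 0 = f (s 0) \<and> (\<forall>x > N. s' x = s x) \<and> t \<le> poly p (size (s 0))"
proof -
  obtain c and p :: "nat poly"
    where c: "\<And>d. \<exists>t s. exec c (init d) t s \<and> s 0 = f d \<and> t \<le> poly p (size d)"
    using polytimeE[OF assms] by blast
  obtain n where n: "\<And>x. x \<in> com_vars c \<Longrightarrow> x \<le> n"
    using finite_com_vars[of c] finite_nat_set_iff_bounded_le by auto
  have "\<exists>t s'. exec (Seq (clear n) c) s t s' \<and> s' 0 = f (s 0) \<and> (\<forall>x > n. s' x = s x) \<and>
      t \<le> poly ([:1 + 2 * n:] + p) (size (s 0))" for s
  proof -
    let ?s = "\<lambda>x. if 1 \<le> x \<and> x \<le> n then Null else s x"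
    obtain t z where z: "exec c (init (s 0)) t z" "z 0 = f (s 0)" "t \<le> poly p (size (s 0))"
      using c by blast
    \<comment> \<open>Clearing turns an arbitrary state into one that agrees with
      \<open>init (s 0)\<close> on all registers that \<open>c\<close> uses.\<close>
    have ag: "\<And>x. x \<in> {..n} \<Longrightarrow> init (s 0) x = ?s x"
      by (case_tac "x = 0") (simp_all add: init_def)
    have "com_vars c \<subseteq> {..n}" using n by auto
    then have "\<exists>s'. exec c ?s t s' \<and> (\<forall>x \<in> {..n}. z x = s' x)"
      by (rule exec_agree[OF z(1)]) (rule ag)
    then obtain s' where s': "exec c ?s t s'" "\<forall>x \<in> {..n}. z x = s' x"
      by (elim exE conjE)
    have "s' x = s x" if "x > n" for x
    proof -
      have "s' x = ?s x" by (rule exec_frame[OF s'(1)]) (use n[of x] that in auto)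
      with that show ?thesis by simp
    qed
    moreover have "s' 0 = f (s 0)" using bspec[OF s'(2), of 0] z(2) by simp
    moreover have "1 + 2 * n + t \<le> poly ([:1 + 2 * n:] + p) (size (s 0))" using z(3) by simp
    ultimately show ?thesis using exec.Seq[OF exec_clear[of n s] s'(1)]
      by (intro exI[of _ "1 + 2 * n + t"] exI[of _ s'] conjI allI impI)
  qed
  then show thesis by (rule that)
qed

section \<open>Loops over lists\<close>

fun to_list :: "sexp \<Rightarrow> sexp list" where
  "to_list Null = []"
| "to_list (Dot a b) = a # to_list b"

lemma to_list_list_code [simp]: "to_list (list_code ds) = ds"
  by (induction ds) auto

text \<open>Every tree is a list along its right spine, so any input can be treated as a
  list.\<close>

lemma list_code_to_list [simp]: "list_code (to_list d) = d"
  by (induction d) auto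

lemma length_to_list: "length (to_list d) \<le> size d"
  by (induction d) auto

lemma size_mem: "x \<in> set (to_list d) \<Longrightarrow> size x < size d"
  by (induction d) auto

text \<open>Registers above \<open>N\<close> survive the subroutine: \<open>N + 1\<close> holds the
  fixed parameter, \<open>N + 2\<close> the rest of the list and \<open>N + 3\<close> the
  accumulator. As \<open>B\<close> bounds the accumulator after every prefix of the list, all rounds
  obey the same time bound.\<close>

lemma exec_fold_loop:
  fixes p :: "nat poly"
  assumes sub: "\<And>s. \<exists>t s'. exec c s t s' \<and> s' 0 = f (s 0) \<and> (\<forall>x > N. s' x = s x) \<and>
      t \<le> poly p (size (s 0))"
    and "size e \<le> B" "size l \<le> B"
    and "\<And>xs ys. to_list l = xs @ ys \<Longrightarrow> size (fold (\<lambda>x a. f (Dot x (Dot a e))) xs (s (N + 3))) \<le> B"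
    and "s (N + 1) = e" "s (N + 2) = l"
  defines "body \<equiv> Seq (Assign 0 (Pr (Fst (Var (N + 2))) (Pr (Var (N + 3)) (Var (N + 1)))))
     (Seq c (Seq (Assign (N + 3) (Var 0)) (Assign (N + 2) (Snd (Var (N + 2))))))"
  shows "\<exists>t s'. exec (While (Var (N + 2)) body) s t s' \<and>
     s' (N + 3) = fold (\<lambda>x a. f (Dot x (Dot a e))) (to_list l) (s (N + 3)) \<and>
     t \<le> (1 + length (to_list l)) * (20 + 6 * B + poly p (3 * B + 2))"
  using assms(3-6)
proof (induction l arbitrary: s)
  case Null
  from Null(4) have "val (Var (N + 2)) s = Null" by simp
  note w = exec.WhileFalse[OF this, of body]
  have "1 + expr_time (Var (N + 2)) s \<le> 20" using Null(4) by simp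
  then show ?case using w by (intro exI[of _ "1 + expr_time (Var (N + 2)) s"] exI[of _ s]) simp
next
  case (Dot x l)
  let ?step = "\<lambda>x a. f (Dot x (Dot a e))"
  let ?a = "s (N + 3)"
  let ?T = "20 + 6 * B + poly p (3 * B + 2)"
  let ?s1 = "s(0 := Dot x (Dot ?a e))"
  have sa: "size ?a \<le> B" using Dot.prems(2)[of "[]" "x # to_list l"] by simp
  have sa': "size (?step x ?a) \<le> B" using Dot.prems(2)[of "[x]" "to_list l"] by simp
  have sx: "size (Dot x (Dot ?a e)) \<le> 3 * B + 2" using sa \<open>size e \<le> B\<close> Dot.prems(1) by simp
  obtain t s2 where s2: "exec c ?s1 t s2" "s2 0 = ?step x ?a" "\<And>y. y > N \<Longrightarrow> s2 y = ?s1 y"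
    "t \<le> poly p (size (Dot x (Dot ?a e)))" using sub[of ?s1] by auto
  have t: "t \<le> poly p (3 * B + 2)" using s2(4) monoD[OF poly_nat_mono sx] by (rule le_trans)
  let ?s3 = "s2(N + 3 := ?step x ?a)"
  let ?s4 = "?s3(N + 2 := l)"
  have a1: "exec (Assign 0 (Pr (Fst (Var (N + 2))) (Pr (Var (N + 3)) (Var (N + 1))))) s
      (8 + size x + size l + size ?a + size e) ?s1"
    using Dot.prems(3,4) by (intro exec_AssignI) simp_all
  have a3: "exec (Assign (N + 3) (Var 0)) s2 (2 + size (?step x ?a)) ?s3"
    using exec.Assign[of "N + 3" "Var 0" s2] s2(2) by simp
  have a4: "exec (Assign (N + 2) (Snd (Var (N + 2)))) ?s3 (4 + size x + size l) ?s4"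
    using s2(3) Dot.prems(4) by (intro exec_AssignI) simp_all
  note b = exec.Seq[OF a1 exec.Seq[OF s2(1) exec.Seq[OF a3 a4]], folded body_def]
  have 4: "?s4 (N + 3) = ?step x ?a" "?s4 (N + 1) = e" "?s4 (N + 2) = l"
    using s2(3) Dot.prems(3) by auto
  have 5: "size (fold ?step xs (?s4 (N + 3))) \<le> B" if "to_list l = xs @ ys" for xs ys
    unfolding 4 using Dot.prems(2)[of "x # xs" ys] that by simp
  have "size l \<le> B" using Dot.prems(1) by simp
  have "\<exists>t s'. exec (While (Var (N + 2)) body) ?s4 t s' \<and>
      s' (N + 3) = fold ?step (to_list l) (?s4 (N + 3)) \<and> t \<le> (1 + length (to_list l)) * ?T"
    by (rule Dot.IH(2)) (fact 5 4(2,3) \<open>size l \<le> B\<close>)+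
  then obtain t' s' where s': "exec (While (Var (N + 2)) body) ?s4 t' s'"
    "s' (N + 3) = fold ?step (to_list l) (?step x ?a)" "t' \<le> (1 + length (to_list l)) * ?T"
    unfolding 4(1) by blast
  have "val (Var (N + 2)) s \<noteq> Null" using Dot.prems(4) by simp
  note w = exec.WhileTrue[OF this b s'(1)]
  have xl: "expr_time (Var (N + 2)) s = 2 + size x + size l" "size x + size l < B"
    using Dot.prems(1,4) by simp_all
  have "(1 + length (to_list (Dot x l))) * ?T = ?T + (1 + length (to_list l)) * ?T"
    by (subst mult_Suc[symmetric]) simp
  \<comment> \<open>The list is read three times, the parameter and the old and new accumulator once
    each, which gives \<open>6 * B\<close>; the argument of the subroutine has size at most
    \<open>3 * B + 2\<close>.\<close>
  moreover have "1 + expr_time (Var (N + 2)) s + (8 + size x + size l + size ?a + size e +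
      (t + (2 + size (?step x ?a) + (4 + size x + size l)))) \<le> ?T"
    using t sa sa' \<open>size e \<le> B\<close> xl by linarith
  ultimately have T: "1 + expr_time (Var (N + 2)) s + (8 + size x + size l + size ?a + size e +
      (t + (2 + size (?step x ?a) + (4 + size x + size l)))) + t'
    \<le> (1 + length (to_list (Dot x l))) * ?T"
    using s'(3) by linarith
  have r: "s' (N + 3) = fold ?step (to_list (Dot x l)) ?a" using s'(2) by simp
  show ?case by (rule exI, rule exI, rule conjI, rule w, rule conjI, rule r, rule T)
qed

text \<open>
  The bound on the intermediate accumulators is indispensable: iterating a polynomial-time step can
  square the size of its argument each time.
\<close>

lemma polytime_fold:
  assumes step: "polytime (\<lambda>y. step (car y) (car (cdr y)) (cdr (cdr y)))"
    and "polytime L" "polytime A" "pbound F"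
    and bound: "\<And>d xs ys. to_list (L d) = xs @ ys \<Longrightarrow> size (fold (\<lambda>x a. step x a d) xs (A d)) \<le> F d"
  shows "polytime (\<lambda>d. fold (\<lambda>x a. step x a d) (to_list (L d)) (A d))"
proof -
  let ?f = "\<lambda>y. step (car y) (car (cdr y)) (cdr (cdr y))"
  obtain c N and p :: "nat poly" where
    sub: "\<And>s. \<exists>t s'. exec c s t s' \<and> s' 0 = ?f (s 0) \<and> (\<forall>x > N. s' x = s x) \<and> t \<le> poly p (size (s 0))"
    using polytime_subroutine[OF step] by blast
  \<comment> \<open>The list and the initial accumulator are computed before the loop, packed
    together with the input, and then distributed to the registers of the loop.\<close>
  have "polytime (\<lambda>d. Dot d (Dot (L d) (A d)))"
    by (intro polytime_pair polytime_id assms)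
  then obtain c0 N0 and p0 :: "nat poly" where
    pre: "\<And>s. \<exists>t s'. exec c0 s t s' \<and> s' 0 = Dot (s 0) (Dot (L (s 0)) (A (s 0))) \<and>
       (\<forall>x > N0. s' x = s x) \<and> t \<le> poly p0 (size (s 0))"
    using polytime_subroutine by blast
  let ?body = "Seq (Assign 0 (Pr (Fst (Var (N + 2))) (Pr (Var (N + 3)) (Var (N + 1)))))
     (Seq c (Seq (Assign (N + 3) (Var 0)) (Assign (N + 2) (Snd (Var (N + 2))))))"
  let ?c = "Seq c0 (Seq (Assign (N + 1) (Fst (Var 0))) (Seq (Assign (N + 2) (Fst (Snd (Var 0))))
     (Seq (Assign (N + 3) (Snd (Snd (Var 0)))) (Seq (While (Var (N + 2)) ?body) (Assign 0 (Var (N + 3)))))))"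
  let ?in = "\<lambda>d. Dot d (Dot (L d) (A d))"
  let ?B = "\<lambda>d. size d + size (L d) + F d"
  let ?T = "\<lambda>d. poly p0 (size d) + 14 + 3 * size (?in d) +
     (1 + size (L d)) * (20 + 6 * ?B d + poly p (3 * ?B d + 2)) + F d"
  show ?thesis
  proof (rule polytimeI)
    fix d
    obtain t s where s: "exec c0 (init d) t s" "s 0 = ?in d" "t \<le> poly p0 (size d)"
      using pre[of "init d"] by (auto simp: init_def)
    let ?s1 = "s(N + 1 := d)" let ?s2 = "?s1(N + 2 := L d)" let ?s3 = "?s2(N + 3 := A d)"
    have a1: "exec (Assign (N + 1) (Fst (Var 0))) s (3 + size (?in d)) ?s1"
      using exec.Assign[of "N + 1" "Fst (Var 0)" s] s(2) by (simp add: eval_nat_numeral)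
    have a2: "exec (Assign (N + 2) (Fst (Snd (Var 0)))) ?s1 (4 + size (?in d)) ?s2"
      using exec.Assign[of "N + 2" "Fst (Snd (Var 0))" ?s1] s(2) by (simp add: eval_nat_numeral)
    have a3: "exec (Assign (N + 3) (Snd (Snd (Var 0)))) ?s2 (4 + size (?in d)) ?s3"
      using exec.Assign[of "N + 3" "Snd (Snd (Var 0))" ?s2] s(2) by (simp add: eval_nat_numeral)
    let ?r = "fold (\<lambda>x a. step x a d) (to_list (L d)) (A d)"
    have "size ?r \<le> F d" using bound[of d "to_list (L d)" "[]"] by simp
    have "\<exists>t s'. exec (While (Var (N + 2)) ?body) ?s3 t s' \<and>
       s' (N + 3) = fold (\<lambda>x a. ?f (Dot x (Dot a d))) (to_list (L d)) (?s3 (N + 3)) \<and>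
       t \<le> (1 + length (to_list (L d))) * (20 + 6 * ?B d + poly p (3 * ?B d + 2))"
    proof (rule exec_fold_loop[OF sub])
      show "size (fold (\<lambda>x a. ?f (Dot x (Dot a d))) xs (?s3 (N + 3))) \<le> ?B d"
        if "to_list (L d) = xs @ ys" for xs ys
        using bound[OF that] by simp
    qed simp_all
    then obtain t' s' where s': "exec (While (Var (N + 2)) ?body) ?s3 t' s'" "s' (N + 3) = ?r"
       "t' \<le> (1 + length (to_list (L d))) * (20 + 6 * ?B d + poly p (3 * ?B d + 2))"
      by auto
    note s'(3)
    also have "(1 + length (to_list (L d))) * (20 + 6 * ?B d + poly p (3 * ?B d + 2)) \<le>
        (1 + size (L d)) * (20 + 6 * ?B d + poly p (3 * ?B d + 2))"
      using length_to_list[of "L d"] by (intro mult_right_mono) auto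
    finally have t': "t' \<le> (1 + size (L d)) * (20 + 6 * ?B d + poly p (3 * ?B d + 2))" .
    have a5: "exec (Assign 0 (Var (N + 3))) s' (2 + size ?r) (s'(0 := ?r))"
      using exec.Assign[of 0 "Var (N + 3)" s'] s'(2) by simp
    note run = exec.Seq[OF s(1) exec.Seq[OF a1 exec.Seq[OF a2 exec.Seq[OF a3 exec.Seq[OF s'(1) a5]]]]]
    have "t + (3 + size (?in d) + (4 + size (?in d) + (4 + size (?in d) + (t' + (2 + size ?r))))) \<le> ?T d"
      using s(3) t' \<open>size ?r \<le> F d\<close> by linarith
    then show "\<exists>t s. exec ?c (init d) t s \<and> s 0 = ?r \<and> t \<le> ?T d"
      by (rule exec_within[OF run, rotated]) simp
  qed (intro pbound_intros assms polytime_pair polytime_id)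
qed

section \<open>Reversal, concatenation and mapping of lists\<close>

definition reverse :: "sexp \<Rightarrow> sexp" where
  "reverse l = list_code (rev (to_list l))"

definition append_lists :: "sexp \<Rightarrow> sexp \<Rightarrow> sexp" where
  "append_lists l m = list_code (to_list l @ to_list m)"

definition concat_map :: "(sexp \<Rightarrow> sexp) \<Rightarrow> sexp \<Rightarrow> sexp" where
  "concat_map F l = list_code (concat (map (\<lambda>x. to_list (F x)) (to_list l)))"

lemma fold_Dot: "fold Dot xs a = list_code (rev xs @ to_list a)"
  by (induction xs arbitrary: a) auto

lemma size_fold_Dot: "size (fold Dot xs a) = size (list_code xs) + size a"
  by (induction xs arbitrary: a) auto

lemma size_list_code_append: "size (list_code (xs @ ys)) = size (list_code xs) + size (list_code ys)"
  by (induction xs) auto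

lemma size_append_lists: "size (append_lists l m) = size l + size m"
  unfolding append_lists_def size_list_code_append by simp

lemma polytime_fold_Dot:
  assumes "polytime f" "polytime g"
  shows "polytime (\<lambda>d. fold Dot (to_list (f d)) (g d))"
proof (rule polytime_fold[where step = "\<lambda>x a d. Dot x a" and F = "\<lambda>d. size (f d) + size (g d)"])
  fix d xs ys assume "to_list (f d) = xs @ ys"
  then have "size (f d) = size (list_code xs) + size (list_code ys)"
    by (metis list_code_to_list size_list_code_append)
  then show "size (fold Dot xs (g d)) \<le> size (f d) + size (g d)" by (simp add: size_fold_Dot)
qed (intro polytime_pair polytime_car polytime_cdr polytime_id assms pbound_intros)+

lemma polytime_reverse:
  assumes "polytime f"
  shows "polytime (\<lambda>d. reverse (f d))"
  using polytime_fold_Dot[OF assms polytime_const[of Null]] by (simp add: reverse_def fold_Dot)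

lemma polytime_append_lists:
  assumes "polytime f" "polytime g"
  shows "polytime (\<lambda>d. append_lists (f d) (g d))"
  using polytime_fold_Dot[OF polytime_reverse[OF assms(1)] assms(2)]
  by (simp add: reverse_def append_lists_def fold_Dot)

lemma fold_append_lists:
  "fold (\<lambda>x. append_lists (F x)) xs a = list_code (concat (map (\<lambda>x. to_list (F x)) (rev xs)) @ to_list a)"
  by (induction xs arbitrary: a) (auto simp: append_lists_def)

lemma size_fold_append_lists:
  "(\<And>x. x \<in> set xs \<Longrightarrow> size (F x) \<le> B) \<Longrightarrow> size (fold (\<lambda>x. append_lists (F x)) xs a) \<le> length xs * B + size a"
proof (induction xs arbitrary: a)
  case (Cons x xs)
  then have "size (fold (\<lambda>x. append_lists (F x)) xs (append_lists (F x) a)) \<le> length xs * B + size (append_lists (F x) a)" by simp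
  also have "\<dots> \<le> length xs * B + (B + size a)" using Cons.prems[of x] by (simp add: size_append_lists)
  finally show ?case by simp
qed simp

text \<open>New pieces go to the front, so the fold runs over the reversed list. List elements are
  smaller than the list, hence all values of \<open>F\<close> share one polynomial bound, and the
  accumulator never exceeds the length of the list times that bound.\<close>

lemma polytime_concat_map:
  assumes F: "polytime (\<lambda>y. F (car y) (cdr y))" and L: "polytime L"
  shows "polytime (\<lambda>d. concat_map (\<lambda>x. F x d) (L d))"
proof -
  obtain q :: "nat poly" where q: "\<And>y. size (F (car y) (cdr y)) \<le> poly q (size y)"
    using polytime_size[OF F] by blast
  have "polytime (\<lambda>d. fold (\<lambda>x a. append_lists (F x d) a) (to_list (reverse (L d))) Null)"
  proof (rule polytime_fold[where step = "\<lambda>x a d. append_lists (F x d) a" and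
        F = "\<lambda>d. size (L d) * poly q (size (L d) + size d + 1)"])
    show "polytime (\<lambda>y. append_lists (F (car y) (cdr (cdr y))) (car (cdr y)))"
      using polytime_comp[OF polytime_pair[OF polytime_car[OF polytime_id]
          polytime_cdr[OF polytime_cdr[OF polytime_id]]] F]
      by (intro polytime_append_lists polytime_car polytime_cdr polytime_id) simp
  next
    fix d xs ys assume *: "to_list (reverse (L d)) = xs @ ys"
    have "rev (to_list (L d)) = xs @ ys" using * by (simp add: reverse_def)
    then have set: "set xs \<subseteq> set (to_list (L d))" and len: "length xs \<le> length (to_list (L d))"
      by (metis Un_upper1 set_append set_rev) (metis le_add1 length_append length_rev \<open>rev (to_list (L d)) = xs @ ys\<close>)
    have "size (F x d) \<le> poly q (size (L d) + size d + 1)" if "x \<in> set xs" for x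
    proof -
      have "size (Dot x d) \<le> size (L d) + size d + 1"
        using size_mem[of x "L d"] that set by auto
      with q[of "Dot x d"] show ?thesis using monoD[OF poly_nat_mono] by (simp add: le_trans)
    qed
    from size_fold_append_lists[of xs "\<lambda>x. F x d", OF this, of Null]
    have "size (fold (\<lambda>x a. append_lists (F x d) a) xs Null) \<le> length xs * poly q (size (L d) + size d + 1)"
      by simp
    also have "\<dots> \<le> size (L d) * poly q (size (L d) + size d + 1)"
      using len length_to_list[of "L d"] by (intro mult_right_mono) auto
    finally show "size (fold (\<lambda>x a. append_lists (F x d) a) xs Null) \<le> \<dots>" .
  qed (intro polytime_reverse polytime_const L pbound_intros)+
  then show ?thesis by (simp add: fold_append_lists reverse_def concat_map_def)
qed

section \<open>Lists as finite sets\<close>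

definition elements :: "sexp \<Rightarrow> sexp set" where
  "elements d = set (to_list d)"

lemma elements_simps [simp]:
  "elements Null = {}" "elements (Dot a b) = insert a (elements b)" "elements (list_code ds) = set ds"
  "elements (append_lists l m) = elements l \<union> elements m" "elements (concat_map F l) = (\<Union>x \<in> elements l. elements (F x))"
  by (auto simp: elements_def append_lists_def concat_map_def)

lemma finite_elements: "finite (elements d)"
  by (simp add: elements_def)

lemma elements_empty_iff: "elements d = {} \<longleftrightarrow> d = Null"
  by (cases d) auto

text \<open>The tree for a true test is a one-element list and the one for a false test is empty, so
  a witness exists exactly if their concatenation is nonempty.\<close>

lemma polytime_pred_bex:
  assumes "polytime_pred (\<lambda>y. P (car y) (cdr y))" "polytime L"
  shows "polytime_pred (\<lambda>d. \<exists>x \<in> elements (L d). P x d)"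
proof -
  let ?m = "\<lambda>d. concat_map (\<lambda>x. truth (P x d)) (L d)"
  have "polytime ?m"
    by (rule polytime_concat_map) (use assms in \<open>auto simp: polytime_pred_def\<close>)
  then have "polytime_pred (\<lambda>d. \<not> ?m d = Null)"
    by (intro polytime_pred_not polytime_pred_eq polytime_const)
  moreover have "\<not> ?m d = Null \<longleftrightarrow> (\<exists>x \<in> elements (L d). P x d)" for d
    by (subst elements_empty_iff[symmetric]) auto
  ultimately show ?thesis by (simp only:)
qed

lemma polytime_pred_mem:
  assumes "polytime f" "polytime L"
  shows "polytime_pred (\<lambda>d. f d \<in> elements (L d))"
proof -
  have "polytime_pred (\<lambda>d. \<exists>x \<in> elements (L d). x = f d)"
    by (intro polytime_pred_bex polytime_pred_eq polytime_car polytime_id assms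
        polytime_comp[OF polytime_cdr[OF polytime_id] assms(1)])
  then show ?thesis by simp
qed

text \<open>Codes of sets must be repetition-free, whereas the generated lists may name an element
  several times.\<close>

definition remove_duplicates :: "sexp \<Rightarrow> sexp" where
  "remove_duplicates l = fold (\<lambda>x a. if x \<in> elements a then a else Dot x a) (to_list l) Null"

lemma elements_remove_duplicates [simp]: "elements (remove_duplicates l) = elements l"
proof -
  have "elements (fold (\<lambda>x a. if x \<in> elements a then a else Dot x a) xs a) = set xs \<union> elements a" for xs a
    by (induction xs arbitrary: a) auto
  then show ?thesis by (simp add: remove_duplicates_def elements_def)
qed

lemma distinct_remove_duplicates: "distinct (to_list (remove_duplicates l))"
proof -
  have "distinct (to_list (fold (\<lambda>x a. if x \<in> elements a then a else Dot x a) xs a))"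
    if "distinct (to_list a)" for xs a
    using that by (induction xs arbitrary: a) (auto simp: elements_def)
  then show ?thesis by (simp add: remove_duplicates_def)
qed

lemma polytime_remove_duplicates:
  assumes "polytime f"
  shows "polytime (\<lambda>d. remove_duplicates (f d))"
  unfolding remove_duplicates_def
proof (rule polytime_fold[where step = "\<lambda>x a d. if x \<in> elements a then a else Dot x a" and F = "\<lambda>d. size (f d)"])
  fix d xs ys assume *: "to_list (f d) = xs @ ys"
  have le: "size (fold (\<lambda>x a. if x \<in> elements a then a else Dot x a) xs a) \<le> size (list_code xs) + size a" for a
  proof (induction xs arbitrary: a)
    case (Cons x xs)
    show ?case using Cons.IH[of a] Cons.IH[of "Dot x a"] by simp
  qed simp
  have "size (f d) = size (list_code xs) + size (list_code ys)"
    using * by (metis list_code_to_list size_list_code_append)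
  with le[of Null] show "size (fold (\<lambda>x a. if x \<in> elements a then a else Dot x a) xs Null) \<le> size (f d)"
    by simp
qed (intro polytime_if polytime_pred_mem polytime_pair polytime_car polytime_cdr polytime_id
    polytime_const assms pbound_intros)+

text \<open>One cell of the first list is removed for each element of the second; the result is
  empty exactly if the first list is not longer. This compares lengths without coding
  numbers.\<close>

lemma polytime_pred_length_le:
  assumes "polytime f" "polytime g"
  shows "polytime_pred (\<lambda>d. length (to_list (f d)) \<le> length (to_list (g d)))"
proof -
  have fold: "to_list (fold (\<lambda>x. cdr) xs a) = drop (length xs) (to_list a)" for xs a
  proof (induction xs arbitrary: a)
    case (Cons x xs)
    have "to_list (cdr a) = drop 1 (to_list a)" by (cases a) auto
    with Cons show ?case by simp
  qed simp
  have "size (fold (\<lambda>x. cdr) xs a) \<le> size a" for xs a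
    by (induction xs arbitrary: a) (auto intro: le_trans[OF _ size_cdr])
  then have "polytime (\<lambda>d. fold (\<lambda>x a. cdr a) (to_list (g d)) (f d))"
    by (intro polytime_fold[where step = "\<lambda>x a d. cdr a" and F = "\<lambda>d. size (f d)"]
        polytime_car polytime_cdr polytime_id assms pbound_intros)
  then have "polytime_pred (\<lambda>d. fold (\<lambda>x. cdr) (to_list (g d)) (f d) = Null)"
    by (intro polytime_pred_eq polytime_const)
  moreover have "fold (\<lambda>x. cdr) (to_list (g d)) (f d) = Null \<longleftrightarrow>
      length (to_list (f d)) \<le> length (to_list (g d))" for d
    using fold[of "to_list (g d)" "f d"] by (metis drop_eq_Nil list_code.simps(1) list_code_to_list to_list.simps(1))
  ultimately show ?thesis by (simp only:)
qed

lemmas polytime_intros = polytime_id polytime_const polytime_car polytime_cdr polytime_pair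
  polytime_if polytime_append_lists polytime_concat_map polytime_remove_duplicates polytime_pred_eq polytime_pred_const
  polytime_pred_not polytime_pred_conj polytime_pred_bex polytime_pred_mem polytime_pred_length_le

section \<open>The hub network\<close>

text \<open>
  The hub is the tree \<open>Null\<close>.  The flag \<open>i\<close> tells the two copies apart, and \<open>customer i k u\<close> is the
  customer for \<open>u\<close> that is charged as the object \<open>k\<close>.  Objects and customers share the position of the
  object, so that \<open>picked\<close> below needs no case distinction.
\<close>

definition object :: "bool \<Rightarrow> sexp \<Rightarrow> sexp" where
  "object i s = Dot (truth i) (Dot s Null)"

definition customer :: "bool \<Rightarrow> sexp \<Rightarrow> sexp \<Rightarrow> sexp" where
  "customer i k u = Dot (truth i) (Dot k (Dot u Null))"

definition middle :: "bool \<Rightarrow> sexp \<Rightarrow> sexp \<Rightarrow> sexp" where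
  "middle i k t = Dot (Dot (Dot Null Null) Null) (Dot (truth i) (Dot k t))"

text \<open>Objects and customers are lists of length two and three headed by a truth value. The
  head of a middle vertex is neither truth value, and the hub is the only leaf.\<close>

lemma vertex_simps [simp]:
  "object i s = object j t \<longleftrightarrow> i = j \<and> s = t"
  "customer i k u = customer j l v \<longleftrightarrow> i = j \<and> k = l \<and> u = v"
  "middle i k a = middle j l b \<longleftrightarrow> i = j \<and> k = l \<and> a = b"
  "object i s \<noteq> customer j k u" "customer j k u \<noteq> object i s" "object i s \<noteq> middle j k a" "middle j k a \<noteq> object i s"
  "customer i k u \<noteq> middle j l a" "middle j l a \<noteq> customer i k u"
  "object i s \<noteq> Null" "customer i k u \<noteq> Null" "middle i k a \<noteq> Null"
  "Null \<noteq> object i s" "Null \<noteq> customer i k u" "Null \<noteq> middle i k a"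
  by (auto simp: object_def customer_def middle_def)

text \<open>
  \<open>D\<close> holds the pairs \<open>Dot u s\<close> where \<open>s\<close> covers \<open>u\<close> alone, and \<open>K\<close> the triples \<open>Dot u (Dot s t)\<close>
  where \<open>s\<close> and \<open>t\<close> fail to cover \<open>u\<close> together; \<open>K\<close> is empty for PDFL.
\<close>

inductive_set arc_set :: "sexp set \<Rightarrow> sexp set \<Rightarrow> sexp set \<Rightarrow> sexp set \<Rightarrow> (sexp \<times> sexp) set"
  for U S D K where
  customer_hub: "k \<in> S \<Longrightarrow> u \<in> U \<Longrightarrow> (customer i k u, Null) \<in> arc_set U S D K"
| customer_object: "k \<in> S \<Longrightarrow> Dot u s \<in> D \<Longrightarrow> (customer i k u, object i s) \<in> arc_set U S D K"
| customer_middle: "k \<in> S \<Longrightarrow> Dot u (Dot s t) \<in> K \<Longrightarrow> (customer i k u, middle i k (Dot u (Dot s t))) \<in> arc_set U S D K"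
| middle_first: "k \<in> S \<Longrightarrow> Dot u (Dot s t) \<in> K \<Longrightarrow> (middle i k (Dot u (Dot s t)), object i s) \<in> arc_set U S D K"
| middle_second: "k \<in> S \<Longrightarrow> Dot u (Dot s t) \<in> K \<Longrightarrow> (middle i k (Dot u (Dot s t)), object i t) \<in> arc_set U S D K"
| middle_hub: "k \<in> S \<Longrightarrow> a \<in> K \<Longrightarrow> (middle i k a, Null) \<in> arc_set U S D K"
| object_hub: "s \<in> S \<Longrightarrow> (object i s, Null) \<in> arc_set U S D K"
| hub_object: "s \<in> S \<Longrightarrow> (Null, object i s) \<in> arc_set U S D K"
| hub_customer: "k \<in> S \<Longrightarrow> u \<in> U \<Longrightarrow> (Null, customer i k u) \<in> arc_set U S D K"

text \<open>
  Cost \<open>0\<close> means avoiding the hub.  Leaving an object costs \<open>2\<close>, more than the route of cost \<open>1\<close> through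
  the hub, so no object lies in the interior of a shortest path that starts at a customer.
\<close>

definition hub_weight :: "sexp \<times> sexp \<Rightarrow> real" where
  "hub_weight a = (if snd a = Null then (if \<exists>i s. fst a = object i s then 2 else 1) else 0)"

definition object_vertices :: "sexp set \<Rightarrow> sexp set" where
  "object_vertices S = {object i s | i s. s \<in> S}"

definition customer_vertices :: "sexp set \<Rightarrow> sexp set \<Rightarrow> sexp set" where
  "customer_vertices U S = {customer i k u | i k u. k \<in> S \<and> u \<in> U}"

definition middle_vertices :: "sexp set \<Rightarrow> sexp set \<Rightarrow> sexp set" where
  "middle_vertices S K = {middle i k a | i k a. k \<in> S \<and> a \<in> K}"

definition hub_instance :: "sexp set \<Rightarrow> sexp set \<Rightarrow> sexp set \<Rightarrow> sexp set \<Rightarrow> sexp dfl_instance" where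
  "hub_instance U S D K =
     \<lparr> graph = \<lparr> pverts = insert Null (object_vertices S \<union> customer_vertices U S \<union> middle_vertices S K), parcs = arc_set U S D K \<rparr>,
       weight = hub_weight, customers = customer_vertices U S, facilities = object_vertices S \<union> customer_vertices U S \<rparr>"

definition picked :: "sexp set \<Rightarrow> bool \<Rightarrow> sexp set \<Rightarrow> sexp set" where
  "picked S i y = {s \<in> S. \<exists>v \<in> y. car v = truth i \<and> car (cdr v) = s}"

lemma hub_instance_simps [simp]:
  "pverts (graph (hub_instance U S D K)) = insert Null (object_vertices S \<union> customer_vertices U S \<union> middle_vertices S K)"
  "parcs (graph (hub_instance U S D K)) = arc_set U S D K"
  "weight (hub_instance U S D K) = hub_weight" "customers (hub_instance U S D K) = customer_vertices U S"
  "facilities (hub_instance U S D K) = object_vertices S \<union> customer_vertices U S"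
  by (simp_all add: hub_instance_def)

lemma hub_weight_simps [simp]:
  "hub_weight (object i s, Null) = 2" "hub_weight (customer i k u, Null) = 1" "hub_weight (middle i k a, Null) = 1"
  "v \<noteq> Null \<Longrightarrow> hub_weight (x, v) = 0"
  by (auto simp: hub_weight_def)

lemma hub_weight_nonneg [simp]: "0 \<le> hub_weight a"
  by (simp add: hub_weight_def)

lemma picked_object: "s \<in> S \<Longrightarrow> object i s \<in> y \<Longrightarrow> s \<in> picked S i y"
  unfolding picked_def object_def by force

lemma picked_customer: "k \<in> S \<Longrightarrow> customer i k u \<in> y \<Longrightarrow> k \<in> picked S i y"
  unfolding picked_def customer_def by force

text \<open>A vertex carries one flag and one charged object, so the two copies pick from disjoint
  parts of \<open>y\<close>, at most one object per vertex.\<close>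

lemma card_picked:
  assumes "finite y"
  shows "card (picked S True y) + card (picked S False y) \<le> card y"
proof -
  let ?y = "\<lambda>i. {v \<in> y. car v = truth i}"
  have "card (picked S i y) \<le> card (?y i)" for i
  proof -
    have sub: "picked S i y \<subseteq> (\<lambda>v. car (cdr v)) ` ?y i"
    proof
      fix s assume "s \<in> picked S i y"
      then show "s \<in> (\<lambda>v. car (cdr v)) ` ?y i" unfolding picked_def by blast
    qed
    have fin: "finite (?y i)" using assms by simp
    have "card (picked S i y) \<le> card ((\<lambda>v. car (cdr v)) ` ?y i)"
      using sub fin by (intro card_mono finite_imageI)
    also have "\<dots> \<le> card (?y i)" using fin by (rule card_image_le)
    finally show ?thesis .
  qed
  then have "card (picked S True y) + card (picked S False y) \<le> card (?y True) + card (?y False)"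
    by (intro add_mono)
  also have "\<dots> = card (?y True \<union> ?y False)"
    using assms by (intro card_Un_disjoint[symmetric]) auto
  also have "\<dots> \<le> card y" using assms by (intro card_mono) auto
  finally show ?thesis .
qed

lemma card_object_vertices:
  assumes "finite X"
  shows "card (object_vertices X) = 2 * card X"
proof -
  have "object_vertices X = (\<lambda>(i, s). object i s) ` (UNIV \<times> X)" by (auto simp: object_vertices_def)
  moreover have "inj_on (\<lambda>(i, s). object i s) (UNIV \<times> X)" by (auto simp: inj_on_def)
  ultimately show ?thesis by (simp add: card_image card_cartesian_product)
qed

section \<open>Validity of the network\<close>

locale hub_network =
  fixes U S D K :: "sexp set"
  assumes finite_ground: "finite U" and finite_objects: "finite S" and finite_K: "finite K"
    and D_form: "a \<in> D \<Longrightarrow> \<exists>u s. a = Dot u s \<and> u \<in> U \<and> s \<in> S"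
    and K_dom: "a \<in> K \<Longrightarrow> \<exists>u s t. a = Dot u (Dot s t) \<and> u \<in> U \<and> s \<in> S \<and> t \<in> S"
begin

abbreviation "J \<equiv> hub_instance U S D K"
abbreviation "A \<equiv> arc_set U S D K"
abbreviation "walk_cost p \<equiv> sum_list (map hub_weight p)"

lemma D_dom: "Dot u s \<in> D \<Longrightarrow> u \<in> U \<and> s \<in> S"
  using D_form by fastforce

lemma arc_verts:
  assumes "(x, y) \<in> A"
  shows "x \<in> pverts (graph J) \<and> y \<in> pverts (graph J)"
  using assms by cases (auto simp: object_vertices_def customer_vertices_def middle_vertices_def dest: D_dom K_dom)

lemma finite_verts: "finite (pverts (graph J))"
proof -
  have "object_vertices S = (\<lambda>(i, s). object i s) ` (UNIV \<times> S)" by (auto simp: object_vertices_def)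
  moreover have "customer_vertices U S = (\<lambda>(i, k, u). customer i k u) ` (UNIV \<times> S \<times> U)"
    by (auto simp: customer_vertices_def image_iff)
  moreover have "middle_vertices S K = (\<lambda>(i, k, a). middle i k a) ` (UNIV \<times> S \<times> K)"
    by (auto simp: middle_vertices_def image_iff)
  ultimately show ?thesis using finite_ground finite_objects finite_K by simp
qed

lemma digraph_J: "pair_fin_digraph (graph J)"
proof
  have "A \<subseteq> pverts (graph J) \<times> pverts (graph J)" using arc_verts by (auto simp del: hub_instance_simps)
  then show "finite (parcs (graph J))"
    using finite_verts by (auto intro: finite_subset)
  show "fst e \<in> pverts (graph J)" "snd e \<in> pverts (graph J)" if "e \<in> parcs (graph J)" for e
    using arc_verts[of "fst e" "snd e"] that by simp_all
qed (rule finite_verts)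

text \<open>Every vertex other than the hub has an arc to the hub, and the hub has arcs to all
  facilities. A middle vertex is entered from its customer, which is a vertex by
  \<open>K_dom\<close>.\<close>

lemma dfl_valid_J: "dfl_valid J"
proof -
  interpret pair_fin_digraph "graph J" by (rule digraph_J)
  have to: "v \<rightarrow>\<^sup>*\<^bsub>with_proj (graph J)\<^esub> Null" if "v \<in> pverts (graph J)" for v
  proof (cases "v = Null")
    case False
    then have "(v, Null) \<in> A"
      using that by (auto simp: object_vertices_def customer_vertices_def middle_vertices_def intro: arc_set.intros)
    then show ?thesis by (intro reachable_adjI) simp
  qed (use that in \<open>auto intro!: reachable_refl\<close>)
  have fac: "Null \<rightarrow>\<^sup>*\<^bsub>with_proj (graph J)\<^esub> v" if "v \<in> object_vertices S \<union> customer_vertices U S" for v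
  proof -
    have "(Null, v) \<in> A" using that by (auto simp: object_vertices_def customer_vertices_def intro: arc_set.intros)
    then show ?thesis by (intro reachable_adjI) simp
  qed
  have "Null \<rightarrow>\<^sup>*\<^bsub>with_proj (graph J)\<^esub> v" if v: "v \<in> pverts (graph J)" for v
  proof -
    consider "v = Null" | "v \<in> object_vertices S \<union> customer_vertices U S" | "v \<in> middle_vertices S K" using v by auto
    then show ?thesis
    proof cases
      case 3
      then obtain i k a where a: "v = middle i k a" "k \<in> S" "a \<in> K" by (auto simp: middle_vertices_def)
      then obtain u s t where u: "a = Dot u (Dot s t)" "u \<in> U" using K_dom by blast
      have "Null \<rightarrow>\<^sup>*\<^bsub>with_proj (graph J)\<^esub> customer i k u"
        using a u by (intro fac) (auto simp: customer_vertices_def)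
      moreover have "customer i k u \<rightarrow>\<^sup>*\<^bsub>with_proj (graph J)\<^esub> v"
        using a u by (intro reachable_adjI) (auto intro: arc_set.intros)
      ultimately show ?thesis by (rule reachable_trans)
    qed (use v fac in \<open>auto intro!: reachable_refl\<close>)
  qed
  with to have "strongly_connected (with_proj (graph J))"
    by (auto simp: strongly_connected_def intro: reachable_trans simp del: hub_instance_simps)
       (auto simp: hub_instance_simps)
  then show ?thesis using digraph_J by (auto simp: dfl_valid_def)
qed

section \<open>Paths in the network and their costs\<close>

lemma cost_eq: "wf_digraph.awalk_cost w p = sum_list (map w p)" for p :: "(sexp \<times> sexp) list"
proof -
  interpret pair_fin_digraph "graph J" by (rule digraph_J)
  \<comment> \<open>The cost ignores the graph, so its definition may be unfolded in this particular
    one.\<close>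
  show ?thesis by (rule wf_digraph.awalk_cost_def[OF wf_digraph])
qed

text \<open>This is \<open>apath\<close> in terms of \<open>pcas\<close> and
  \<open>pawalk_verts\<close>, which the simplifier evaluates on explicit arc lists.\<close>

definition simple_path :: "sexp \<Rightarrow> (sexp \<times> sexp) list \<Rightarrow> sexp \<Rightarrow> bool" where
  "simple_path c p f \<longleftrightarrow> c \<in> pverts (graph J) \<and> set p \<subseteq> A \<and> pcas c p f \<and> distinct (pawalk_verts c p)"

lemma shortest_iff:
  "p \<in> shortest_paths J c f \<longleftrightarrow> simple_path c p f \<and> (\<forall>q. simple_path c q f \<longrightarrow> walk_cost p \<le> walk_cost q)"
  by (auto simp: shortest_paths_def pre_digraph.apath_def pre_digraph.awalk_def simple_path_def
      cas_with_proj_eq awalk_verts_with_proj_eq cost_eq)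

lemma meet_iff:
  "meet_only_at J c p q \<longleftrightarrow> set (pawalk_verts c p) \<inter> set (pawalk_verts c q) \<subseteq> {c}"
  by (simp add: meet_only_at_def awalk_verts_with_proj_eq)

lemma walk_cost_nonneg: "0 \<le> walk_cost p"
  by (induction p) auto

text \<open>A walk that starts elsewhere must enter the hub, and each arc into the hub weighs 1 or
  2.\<close>

lemma hub_cost:
  assumes "set p \<subseteq> A" "pcas c p f" "c \<noteq> Null" "Null \<in> set (pawalk_verts c p)"
  shows "1 \<le> walk_cost p"
  using assms
proof (induction p arbitrary: c)
  case (Cons e p)
  obtain y where e: "e = (c, y)" using Cons.prems(2) by (cases e) auto
  show ?case
  proof (cases "y = Null")
    case True
    then have "1 \<le> hub_weight e" by (simp add: hub_weight_def e)
    then show ?thesis using walk_cost_nonneg[of p] by simp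
  next
    case False
    then have "1 \<le> walk_cost p" using Cons e by auto
    then show ?thesis by (simp add: add_increasing)
  qed
qed simp

text \<open>The only arc out of an object leads to the hub and weighs 2, and a walk that visits an
  object without ending there has to use it.\<close>

lemma object_cost:
  assumes "set p \<subseteq> A" "pcas c p f" "object i s \<in> set (pawalk_verts c p)" "f \<noteq> object i s"
  shows "2 \<le> walk_cost p"
  using assms
proof (induction p arbitrary: c)
  case (Cons e p)
  obtain y where e: "e = (c, y)" using Cons.prems(2) by (cases e) auto
  show ?case
  proof (cases "c = object i s")
    case True
    with e Cons.prems(1) have "(object i s, y) \<in> A" by simp
    then have "hub_weight e = 2" using e True by cases auto
    then show ?thesis using walk_cost_nonneg[of p] by simp
  next
    case False
    then have "2 \<le> walk_cost p" using Cons e by auto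
    then show ?thesis by (simp add: add_increasing)
  qed
qed auto

text \<open>Objects lead only to the hub, so a path that avoids the hub ends at its first object.
  From a customer an object is reached directly or through one middle vertex; middle vertices
  themselves are not facilities.\<close>

lemma hub_avoiding:
  assumes "set p \<subseteq> A" "pcas (customer i k u) p f" "Null \<notin> set (pawalk_verts (customer i k u) p)"
    and "f \<in> facilities J" "f \<noteq> customer i k u"
  obtains s where "f = object i s" "Dot u s \<in> D" "p = [(customer i k u, f)]"
  | s a b where "f = object i s" "Dot u (Dot a b) \<in> K" "s = a \<or> s = b"
      "p = [(customer i k u, middle i k (Dot u (Dot a b))), (middle i k (Dot u (Dot a b)), f)]"
proof -
  have stuck: "q = [] \<and> f = object j s"
    if "set q \<subseteq> A" "pcas (object j s) q f" "Null \<notin> set (pawalk_verts (object j s) q)" for q j s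
  proof (cases q)
    case (Cons e q')
    then have "e \<in> A" "fst e = object j s" "snd e \<noteq> Null"
      using that by (auto, cases q', auto)
    then show ?thesis by (cases e) (auto elim: arc_set.cases)
  qed (use that in auto)
  have hd: "x \<noteq> Null" if "Null \<notin> set (pawalk_verts x q)" "pcas x q f" for x q
    using that by (cases q) auto
  from assms(2,5) obtain y p' where p: "p = (customer i k u, y) # p'" by (cases p) auto
  have p': "set p' \<subseteq> A" "pcas y p' f" "Null \<notin> set (pawalk_verts y p')"
    using assms p by auto
  have "(customer i k u, y) \<in> A" using assms(1) p by simp
  then show thesis
  proof cases
    case (customer_object k' u' s i')
    then show thesis using stuck[of p' i s] p' p that(1)[of s] by auto
  next
    case (customer_middle k' u' a b i')
    let ?m = "middle i k (Dot u (Dot a b))"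
    have y: "y = ?m" "Dot u (Dot a b) \<in> K" using customer_middle by auto
    have "f \<noteq> ?m" using assms(4) by (auto simp: object_vertices_def customer_vertices_def)
    with p'(2) y obtain z p'' where pp: "p' = (?m, z) # p''" by (cases p') auto
    have p'': "set p'' \<subseteq> A" "pcas z p'' f" "Null \<notin> set (pawalk_verts z p'')"
      using p' pp by auto
    have "(?m, z) \<in> A" using p' pp by simp
    then obtain s where "z = object i s" "s = a \<or> s = b"
      using hd[OF p''(3,2)] by cases auto
    with stuck[of p'' i s] p'' pp p y that(2)[of s a b] show thesis by auto
  qed (use hd[OF p'(3,2)] in auto)
qed

text \<open>The facilities that a customer for \<open>u\<close> in copy \<open>i\<close> reaches at
  cost 0, that is, without the hub.\<close>

definition linked :: "bool \<Rightarrow> sexp \<Rightarrow> sexp \<Rightarrow> bool" where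
  "linked i u f \<longleftrightarrow>
     (\<exists>s. f = object i s \<and> (Dot u s \<in> D \<or> (\<exists>a b. Dot u (Dot a b) \<in> K \<and> (s = a \<or> s = b))))"

section \<open>Which pairs of facilities cover a given customer\<close>

context
  fixes i :: bool and k u :: sexp
  assumes k: "k \<in> S" and u: "u \<in> U"
begin

abbreviation (input) "c \<equiv> customer i k u"

lemma c_vert: "c \<in> pverts (graph J)"
  using k u by (auto simp: customer_vertices_def)

lemma hub_path:
  assumes "f \<in> facilities J" "f \<noteq> c"
  shows "simple_path c [(c, Null), (Null, f)] f" "walk_cost [(c, Null), (Null, f)] = 1"
  using assms k u c_vert by (auto simp: simple_path_def object_vertices_def customer_vertices_def intro: arc_set.intros)

lemma middle_path:
  assumes "Dot u (Dot a b) \<in> K" "s = a \<or> s = b"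
  shows "simple_path c [(c, middle i k (Dot u (Dot a b))), (middle i k (Dot u (Dot a b)), object i s)] (object i s)"
    "walk_cost [(c, middle i k (Dot u (Dot a b))), (middle i k (Dot u (Dot a b)), object i s)] = 0"
  using assms k c_vert by (auto simp: simple_path_def intro: arc_set.intros)

text \<open>This detour costs no more than the plain route through the hub. It puts every middle
  vertex of the customer on a shortest path to each unlinked facility.\<close>

lemma middle_hub_path:
  assumes "Dot u (Dot a b) \<in> K" "f \<in> facilities J" "f \<noteq> c"
  shows "simple_path c [(c, middle i k (Dot u (Dot a b))), (middle i k (Dot u (Dot a b)), Null), (Null, f)] f"
    "walk_cost [(c, middle i k (Dot u (Dot a b))), (middle i k (Dot u (Dot a b)), Null), (Null, f)] = 1"
  using assms k u c_vert by (auto simp: simple_path_def object_vertices_def customer_vertices_def intro: arc_set.intros)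

lemma direct_path:
  assumes "Dot u s \<in> D"
  shows "simple_path c [(c, object i s)] (object i s)" "walk_cost [(c, object i s)] = 0"
  using assms k c_vert by (auto simp: simple_path_def intro: arc_set.intros)

lemma zero_cost_shortest:
  "simple_path c p f \<Longrightarrow> walk_cost p = 0 \<Longrightarrow> p \<in> shortest_paths J c f"
  using walk_cost_nonneg by (auto simp: shortest_iff)

lemma unlinked_hub:
  assumes "f \<in> facilities J" "f \<noteq> c" "\<not> linked i u f" "simple_path c p f"
  shows "Null \<in> set (pawalk_verts c p)"
proof (rule ccontr)
  assume "Null \<notin> set (pawalk_verts c p)"
  with assms(4) have "linked i u f"
    unfolding simple_path_def using hub_avoiding[of p i k u f] assms(1,2)
    by (metis linked_def)
  with assms(3) show False by simp
qed

lemma unlinked_shortest: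
  assumes "f \<in> facilities J" "f \<noteq> c" "\<not> linked i u f" "simple_path c p f" "walk_cost p = 1"
  shows "p \<in> shortest_paths J c f"
  unfolding shortest_iff
proof (intro conjI allI impI)
  fix q assume q: "simple_path c q f"
  then have "1 \<le> walk_cost q"
    using unlinked_hub[OF assms(1-3) q] by (intro hub_cost[of q c f]) (auto simp: simple_path_def)
  with assms(5) show "walk_cost p \<le> walk_cost q" by simp
qed (rule assms(4))

text \<open>Through the hub a path costs at least 1, whereas a linked facility is reachable at cost
  0.\<close>

lemma linked_shortest:
  assumes "linked i u f" "p \<in> shortest_paths J c f"
  shows "Null \<notin> set (pawalk_verts c p)"
proof
  assume "Null \<in> set (pawalk_verts c p)"
  then have "1 \<le> walk_cost p" using assms(2)
    by (intro hub_cost[of p c f]) (auto simp: simple_path_def shortest_iff)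
  moreover have "\<exists>q. simple_path c q f \<and> walk_cost q = 0"
    using assms(1) direct_path middle_path unfolding linked_def by metis
  ultimately show False using assms(2) unfolding shortest_iff by force
qed

text \<open>Passing through an object costs 2, yet each facility other than the customer itself is
  reachable at cost 1. Setwise covers need this for all shortest paths at once.\<close>

lemma shortest_avoids_object:
  assumes "f \<in> facilities J" "f \<noteq> c" "f \<noteq> object i s" "p \<in> shortest_paths J c f"
  shows "object i s \<notin> set (pawalk_verts c p)"
proof
  assume "object i s \<in> set (pawalk_verts c p)"
  then have "2 \<le> walk_cost p" using assms
    by (intro object_cost[of p c f i s]) (auto simp: simple_path_def shortest_iff)
  moreover have "walk_cost p \<le> 1"
    using assms(4) hub_path[OF assms(1,2)] unfolding shortest_iff by metis
  ultimately show False by simp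
qed

lemma linkedI: "Dot u s \<in> D \<Longrightarrow> linked i u (object i s)"
  by (auto simp: linked_def)

text \<open>With \<open>K\<close> empty, a direct arc is the only way around the hub. If neither
  facility has one from this customer, all paths to both of them meet in the hub.\<close>

lemma pathwise_coversD:
  assumes "K = {}" "f1 \<in> facilities J - {c}" "f2 \<in> facilities J - {c}" "pathwise_covers J c f1 f2"
  shows "\<exists>s. Dot u s \<in> D \<and> object i s \<in> {f1, f2}"
proof (rule ccontr)
  assume "\<not> ?thesis"
  then have "\<not> linked i u f1" "\<not> linked i u f2" using assms(1) unfolding linked_def by auto
  moreover obtain p q where "p \<in> shortest_paths J c f1" "q \<in> shortest_paths J c f2"
    "meet_only_at J c p q" using assms(4) unfolding pathwise_covers_def by blast
  ultimately have "Null \<in> set (pawalk_verts c p) \<inter> set (pawalk_verts c q)"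
    using assms(2,3) unlinked_hub unfolding shortest_iff by (metis DiffD1 DiffD2 IntI insertI1)
  with \<open>meet_only_at J c p q\<close> show False by (auto simp: meet_iff)
qed

text \<open>A direct arc has no inner vertex, so the other path only has to avoid this object: it is
  another direct arc or the route through the hub.\<close>

lemma pathwise_coversI:
  assumes "K = {}" "Dot u s \<in> D" "f \<in> facilities J - {c}" "f \<noteq> object i s"
  shows "pathwise_covers J c (object i s) f"
proof -
  have "[(c, object i s)] \<in> shortest_paths J c (object i s)"
    using direct_path[OF assms(2)] by (rule zero_cost_shortest)
  moreover have "\<exists>q \<in> shortest_paths J c f. meet_only_at J c [(c, object i s)] q"
  proof (cases "linked i u f")
    case True
    then obtain t where t: "f = object i t" "Dot u t \<in> D" using assms(1) unfolding linked_def by auto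
    have "[(c, object i t)] \<in> shortest_paths J c f"
      unfolding t(1) using direct_path[OF t(2)] by (rule zero_cost_shortest)
    then show ?thesis by (rule bexI[rotated]) (use t(1) assms(4) in \<open>auto simp: meet_iff\<close>)
  next
    case False
    then have "[(c, Null), (Null, f)] \<in> shortest_paths J c f"
      using assms(3) hub_path by (intro unlinked_shortest) auto
    with assms(4) show ?thesis by (intro bexI) (auto simp: meet_iff)
  qed
  ultimately show ?thesis unfolding pathwise_covers_def by blast
qed

lemma linked_through_middle:
  assumes "linked i u f" "p \<in> shortest_paths J c f" "f \<in> facilities J - {c}"
  obtains s where "f = object i s" "Dot u s \<in> D" "set (pawalk_verts c p) = {c, f}"
  | s a b where "f = object i s" "Dot u (Dot a b) \<in> K" "s = a \<or> s = b"
      "set (pawalk_verts c p) = {c, middle i k (Dot u (Dot a b)), f}"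
proof -
  have "Null \<notin> set (pawalk_verts c p)" using linked_shortest[OF assms(1,2)] .
  with assms(2,3) show thesis
    unfolding shortest_iff simple_path_def
    by (elim conjE hub_avoiding[of p i k u f]) (use that in auto)
qed

text \<open>In all other cases some shortest paths meet: two linked facilities share a middle
  vertex, a linked and an unlinked one share the middle vertex of a pair \<open>Dot s s\<close>, and
  two unlinked ones share the hub.\<close>

lemma setwise_coversD:
  assumes complete: "\<And>s. s \<in> S \<Longrightarrow> Dot u s \<in> D \<or> Dot u (Dot s s) \<in> K"
    and "f1 \<in> facilities J - {c}" "f2 \<in> facilities J - {c}" "setwise_covers J c f1 f2"
  shows "(\<exists>s. Dot u s \<in> D \<and> object i s \<in> {f1, f2}) \<or>
    (\<exists>s t. s \<in> S \<and> t \<in> S \<and> f1 = object i s \<and> f2 = object i t \<and> Dot u (Dot s t) \<notin> K \<and> Dot u (Dot t s) \<notin> K)"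
proof (rule ccontr)
  assume no: "\<not> ?thesis"
  have meet: False if "p \<in> shortest_paths J c f1" "q \<in> shortest_paths J c f2"
    "v \<in> set (pawalk_verts c p)" "v \<in> set (pawalk_verts c q)" "v \<noteq> c" for p q v
    using assms(4) that unfolding setwise_covers_def meet_iff by blast
  \<comment> \<open>No direct arc leads to \<open>f1\<close> or \<open>f2\<close> by assumption, so
    \<open>complete\<close> supplies the middle vertex of the diagonal pair.\<close>
  have via_mid: "\<exists>s \<in> S. f = object i s \<and> Dot u (Dot s s) \<in> K" if "linked i u f" "f \<in> {f1, f2}" for f
    using that no complete K_dom D_dom unfolding linked_def by (metis sexp.inject insert_iff)
  have middle: "[(c, middle i k (Dot u (Dot a b))), (middle i k (Dot u (Dot a b)), object i s)] \<in> shortest_paths J c (object i s)"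
    if "Dot u (Dot a b) \<in> K" "s = a \<or> s = b" for a b s
    using middle_path[OF that] by (rule zero_cost_shortest)
  have middle_hub: "[(c, middle i k (Dot u (Dot a b))), (middle i k (Dot u (Dot a b)), Null), (Null, f)] \<in> shortest_paths J c f"
    if "Dot u (Dot a b) \<in> K" "f \<in> facilities J - {c}" "\<not> linked i u f" for a b f
    using that middle_hub_path by (intro unlinked_shortest) auto
  have hub: "[(c, Null), (Null, f)] \<in> shortest_paths J c f"
    if "f \<in> facilities J - {c}" "\<not> linked i u f" for f
    using that hub_path by (intro unlinked_shortest) auto
  consider "linked i u f1" "linked i u f2" | "linked i u f1" "\<not> linked i u f2"
    | "\<not> linked i u f1" "linked i u f2" | "\<not> linked i u f1" "\<not> linked i u f2" by blast
  then show False
  proof cases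
    case 1
    then obtain s t where st: "s \<in> S" "f1 = object i s" "t \<in> S" "f2 = object i t" using via_mid by blast
    then obtain a b where "Dot u (Dot a b) \<in> K" "s = a \<or> s = b" "t = a \<or> t = b" using no by blast
    from meet[of _ _ "middle i k (Dot u (Dot a b))", unfolded st(2,4), OF middle[OF this(1,2)] middle[OF this(1,3)]]
    show False by simp
  next
    case 2
    \<comment> \<open>The path to the unlinked facility makes a detour through the diagonal middle
      vertex on its way to the hub.\<close>
    then obtain s where s: "f1 = object i s" "Dot u (Dot s s) \<in> K" using via_mid by blast
    from meet[of _ _ "middle i k (Dot u (Dot s s))", OF middle[OF s(2), of s, folded s(1)] middle_hub[OF s(2) assms(3) 2(2)]]
    show False by simp
  next
    case 3
    then obtain s where s: "f2 = object i s" "Dot u (Dot s s) \<in> K" using via_mid by blast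
    from meet[of _ _ "middle i k (Dot u (Dot s s))", OF middle_hub[OF s(2) assms(2) 3(1)] middle[OF s(2), of s, folded s(1)]]
    show False by simp
  next
    case 4
    from meet[of _ _ Null, OF hub[OF assms(2) 4(1)] hub[OF assms(3) 4(2)]] show False by simp
  qed
qed

text \<open>Since \<open>s\<close> occurs in no conflict for \<open>u\<close>, the direct arc is the
  only shortest path to it, and shortest paths to other facilities avoid objects in their
  interior.\<close>

lemma setwise_coversI_direct:
  assumes "Dot u s \<in> D" and no_mid: "\<And>a b. Dot u (Dot a b) \<in> K \<Longrightarrow> s \<noteq> a \<and> s \<noteq> b"
    and "f \<in> facilities J - {c}" "f \<noteq> object i s"
  shows "setwise_covers J c (object i s) f"
  unfolding setwise_covers_def meet_iff
proof (intro ballI)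
  fix p q assume p: "p \<in> shortest_paths J c (object i s)" and q: "q \<in> shortest_paths J c f"
  have "object i s \<in> facilities J - {c}" using assms(1) D_dom by (auto simp: object_vertices_def)
  from linked_through_middle[OF linkedI[OF assms(1)] p this]
  have "set (pawalk_verts c p) = {c, object i s}"
    by cases (use no_mid in auto)
  moreover have "object i s \<notin> set (pawalk_verts c q)"
    using assms(3,4) q by (intro shortest_avoids_object) auto
  ultimately show "set (pawalk_verts c p) \<inter> set (pawalk_verts c q) \<subseteq> {c}" by auto
qed

lemma setwise_coversI_pair:
  assumes "s \<in> S" "t \<in> S" "s \<noteq> t" "Dot u (Dot s s) \<in> K" "Dot u (Dot t t) \<in> K"
    and no_direct: "Dot u s \<notin> D" "Dot u t \<notin> D"
    and no_mid: "Dot u (Dot s t) \<notin> K" "Dot u (Dot t s) \<notin> K"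
  shows "setwise_covers J c (object i s) (object i t)"
  unfolding setwise_covers_def meet_iff
proof (intro ballI)
  fix p q assume p: "p \<in> shortest_paths J c (object i s)" and q: "q \<in> shortest_paths J c (object i t)"
  have l: "linked i u (object i s)" "linked i u (object i t)"
    using assms(4,5) by (auto simp: linked_def)
  have f: "object i s \<in> facilities J - {c}" "object i t \<in> facilities J - {c}"
    using assms(1,2) by (auto simp: object_vertices_def)
  from linked_through_middle[OF l(1) p f(1)] obtain a b where ab: "Dot u (Dot a b) \<in> K" "s = a \<or> s = b"
    "set (pawalk_verts c p) = {c, middle i k (Dot u (Dot a b)), object i s}"
    by cases (use no_direct in auto)
  from linked_through_middle[OF l(2) q f(2)] obtain a' b' where ab': "Dot u (Dot a' b') \<in> K" "t = a' \<or> t = b'"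
    "set (pawalk_verts c q) = {c, middle i k (Dot u (Dot a' b')), object i t}"
    by cases (use no_direct in auto)
  \<comment> \<open>A common middle vertex would belong to a conflict that contains both of the
    distinct objects \<open>s\<close> and \<open>t\<close>.\<close>
  have "\<not> (a = a' \<and> b = b')" using ab(1,2) ab'(2) no_mid assms(3) by auto
  with ab(3) ab'(3) assms(3) show "set (pawalk_verts c p) \<inter> set (pawalk_verts c q) \<subseteq> {c}" by auto
qed

end

section \<open>Passing between facility covers and sets of objects\<close>

lemma pathwise_picked:
  assumes "K = {}" "pathwise_disjoint_cover J y" "u \<in> U" "\<exists>s \<in> S. Dot u s \<in> D"
  shows "\<exists>s \<in> picked S i y. Dot u s \<in> D"
proof (cases "\<forall>k \<in> S. customer i k u \<in> y")
  case True
  \<comment> \<open>If all customers for \<open>u\<close> in copy \<open>i\<close> are chosen, every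
    object has been charged, in particular one that covers \<open>u\<close>.\<close>
  then show ?thesis using assms(4) picked_customer by blast
next
  case False
  then obtain k where k: "k \<in> S" "customer i k u \<notin> y" by blast
  let ?c = "customer i k u"
  have "?c \<in> customers J - y" using k assms(3) by (auto simp: customer_vertices_def)
  then obtain f1 f2 where f: "f1 \<in> y - {?c}" "f2 \<in> y - {?c}" "pathwise_covers J ?c f1 f2"
    using assms(2) unfolding pathwise_disjoint_cover_def by blast
  then have "f1 \<in> facilities J - {?c}" "f2 \<in> facilities J - {?c}"
    using assms(2) unfolding pathwise_disjoint_cover_def by blast+
  \<comment> \<open>An unchosen customer for \<open>u\<close> must be covered by a pair, and one
    member of this pair covers \<open>u\<close>.\<close>
  from pathwise_coversD[OF k(1) assms(3,1) this f(3)] obtain s where "Dot u s \<in> D" "object i s \<in> y"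
    using f by auto
  then show ?thesis using picked_object D_dom by blast
qed

text \<open>The covering object in the customer's own copy is paired with its twin in the other
  copy.\<close>

lemma pathwise_lift:
  assumes "K = {}" "X \<subseteq> S" "\<And>u. u \<in> U \<Longrightarrow> \<exists>s \<in> X. Dot u s \<in> D"
  shows "pathwise_disjoint_cover J (object_vertices X)"
  unfolding pathwise_disjoint_cover_def
proof (intro conjI ballI)
  show "object_vertices X \<subseteq> facilities J" using assms(2) by (auto simp: object_vertices_def)
  fix c assume "c \<in> customers J - object_vertices X"
  then obtain i k u where c: "c = customer i k u" "k \<in> S" "u \<in> U" by (auto simp: customer_vertices_def)
  then obtain s where s: "s \<in> X" "Dot u s \<in> D" using assms(3) by blast
  have "pathwise_covers J c (object i s) (object (\<not> i) s)"
    unfolding c(1) using s assms(1,2) c(2,3) by (intro pathwise_coversI) (auto simp: object_vertices_def)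
  then show "\<exists>f1 \<in> object_vertices X - {c}. \<exists>f2 \<in> object_vertices X - {c}. f1 \<noteq> f2 \<and> pathwise_covers J c f1 f2"
    using s(1) c(1) by (intro bexI[of _ "object i s"] bexI[of _ "object (\<not> i) s"]) (auto simp: object_vertices_def)
qed

end

text \<open>The pair \<open>Dot s s\<close> stands for \<open>s\<close> alone: two objects conflict
  only if neither covers the ground element alone, and direct arcs go exactly to the objects that
  do.\<close>

locale conflict_network = hub_network +
  assumes K_sym: "Dot u (Dot s t) \<in> K \<Longrightarrow> Dot u (Dot t s) \<in> K"
    and K_diag: "Dot u (Dot s t) \<in> K \<Longrightarrow> Dot u (Dot s s) \<in> K"
    and D_iff: "u \<in> U \<Longrightarrow> s \<in> S \<Longrightarrow> Dot u s \<in> D \<longleftrightarrow> Dot u (Dot s s) \<notin> K"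
begin

text \<open>The pair covering an unchosen customer for \<open>u\<close> contains an object of copy
  \<open>i\<close> that covers \<open>u\<close> alone, or consists of two nonconflicting objects of
  that copy. If no such customer is left, all objects have been charged.\<close>

lemma setwise_picked:
  assumes "setwise_disjoint_cover J y" "u \<in> U" "\<exists>s \<in> S. \<exists>t \<in> S. Dot u (Dot s t) \<notin> K"
  shows "\<exists>s \<in> picked S i y. \<exists>t \<in> picked S i y. Dot u (Dot s t) \<notin> K"
proof (cases "\<forall>k \<in> S. customer i k u \<in> y")
  case True
  then have "S \<subseteq> picked S i y" using picked_customer by blast
  then show ?thesis using assms(3) by blast
next
  case False
  then obtain k where k: "k \<in> S" "customer i k u \<notin> y" by blast
  let ?c = "customer i k u"
  have "?c \<in> customers J - y" using k assms(2) by (auto simp: customer_vertices_def)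
  then obtain f1 f2 where f: "f1 \<in> y - {?c}" "f2 \<in> y - {?c}" "setwise_covers J ?c f1 f2"
    using assms(1) unfolding setwise_disjoint_cover_def by blast
  then have f': "f1 \<in> facilities J - {?c}" "f2 \<in> facilities J - {?c}"
    using assms(1) unfolding setwise_disjoint_cover_def by blast+
  have "(\<exists>s. Dot u s \<in> D \<and> object i s \<in> {f1, f2}) \<or>
    (\<exists>s t. s \<in> S \<and> t \<in> S \<and> f1 = object i s \<and> f2 = object i t \<and> Dot u (Dot s t) \<notin> K \<and> Dot u (Dot t s) \<notin> K)"
    by (rule setwise_coversD[OF k(1) assms(2) _ f' f(3)]) (use D_iff[OF assms(2)] in blast)
  then show ?thesis
  proof (elim disjE exE conjE)
    fix s assume s: "Dot u s \<in> D" "object i s \<in> {f1, f2}"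
    then have "s \<in> S" "object i s \<in> y" using D_dom f by auto
    then show ?thesis using s(1) D_iff[OF assms(2)] picked_object by blast
  next
    fix s t assume st: "s \<in> S" "t \<in> S" "f1 = object i s" "f2 = object i t" "Dot u (Dot s t) \<notin> K"
    have "s \<in> picked S i y" "t \<in> picked S i y" using st f by (auto intro: picked_object)
    with st(5) show ?thesis by blast
  qed
qed

text \<open>An object that covers \<open>u\<close> alone is paired with its twin in the other copy.
  Otherwise the two objects given for \<open>u\<close> each conflict with themselves, so they are
  distinct and form the pair within the customer's copy.\<close>

lemma setwise_lift:
  assumes "X \<subseteq> S" "\<And>u. u \<in> U \<Longrightarrow> \<exists>s \<in> X. \<exists>t \<in> X. Dot u (Dot s t) \<notin> K"
  shows "setwise_disjoint_cover J (object_vertices X)"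
  unfolding setwise_disjoint_cover_def
proof (intro conjI ballI)
  show "object_vertices X \<subseteq> facilities J" using assms(1) by (auto simp: object_vertices_def)
  fix c assume "c \<in> customers J - object_vertices X"
  then obtain i k u where c: "c = customer i k u" "k \<in> S" "u \<in> U" by (auto simp: customer_vertices_def)
  then obtain s t where st: "s \<in> X" "t \<in> X" "Dot u (Dot s t) \<notin> K" using assms(2) by blast
  have S: "s \<in> S" "t \<in> S" using st assms(1) by auto
  have direct: "\<exists>f1 \<in> object_vertices X - {c}. \<exists>f2 \<in> object_vertices X - {c}. f1 \<noteq> f2 \<and> setwise_covers J c f1 f2" if r: "r \<in> X" "Dot u r \<in> D" for r
  proof -
    have "r \<in> S" using r(1) assms(1) by blast
    then have "Dot u (Dot r r) \<notin> K" using D_iff c(3) r(2) by blast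
    \<comment> \<open>An object that takes part in any conflict for \<open>u\<close> also conflicts
      with itself.\<close>
    then have "Dot u (Dot a b) \<in> K \<Longrightarrow> r \<noteq> a \<and> r \<noteq> b" for a b
      using K_sym K_diag by blast
    moreover have "object (\<not> i) r \<in> facilities J - {customer i k u}" "object (\<not> i) r \<noteq> object i r"
      using \<open>r \<in> S\<close> by (auto simp: object_vertices_def)
    ultimately have "setwise_covers J c (object i r) (object (\<not> i) r)"
      unfolding c(1) using setwise_coversI_direct[OF c(2,3) r(2)] by blast
    then show ?thesis
      using r(1) c(1) by (intro bexI[of _ "object i r"] bexI[of _ "object (\<not> i) r"]) (auto simp: object_vertices_def)
  qed
  show "\<exists>f1 \<in> object_vertices X - {c}. \<exists>f2 \<in> object_vertices X - {c}. f1 \<noteq> f2 \<and> setwise_covers J c f1 f2"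
  proof (cases "Dot u s \<in> D \<or> Dot u t \<in> D")
    case True
    then show ?thesis using direct st by blast
  next
    case False
    then have K: "Dot u (Dot s s) \<in> K" "Dot u (Dot t t) \<in> K" using D_iff S c(3) by auto
    then have "s \<noteq> t" using st(3) by auto
    moreover have "setwise_covers J c (object i s) (object i t)"
      unfolding c(1) using setwise_coversI_pair[OF c(2,3) S \<open>s \<noteq> t\<close> K] False st(3) K_sym by blast
    ultimately show ?thesis
      using st c(1) by (intro bexI[of _ "object i s"] bexI[of _ "object i t"]) (auto simp: object_vertices_def)
  qed
qed

end

section \<open>Programs for the reductions\<close>

lemma set_codes_singleton:
  "d \<in> set_codes (\<lambda>x. {h x}) B \<longleftrightarrow> (\<exists>xs. distinct xs \<and> set xs = B \<and> to_list d = map h xs)"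
proof -
  have "list_all2 (\<lambda>x d. d \<in> {h x}) xs ds \<longleftrightarrow> ds = map h xs" for xs ds
    by (auto simp: list_all2_conv_all_nth intro: nth_equalityI)
  then show ?thesis
    unfolding set_codes_def by (auto) (metis list_code_to_list)
qed

lemma set_codes_id: "d \<in> set_codes id_codes B \<longleftrightarrow> elements d = B \<and> distinct (to_list d)"
proof -
  have "id_codes = (\<lambda>x. {id x})" by (simp add: fun_eq_iff id_codes_def)
  then have "set_codes id_codes B = set_codes (\<lambda>x. {id x}) B" by (rule arg_cong)
  with set_codes_singleton[of d id B] show ?thesis by (auto simp: elements_def)
qed

text \<open>Here \<open>h\<close> selects one code per element; inverting it on the listed codes
  yields the repetition-free listing of \<open>B\<close> that \<open>set_codes\<close> asks
  for.\<close>

lemma remove_duplicates_set_codes: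
  assumes "elements l = h ` B" "inj_on h B" "\<And>x. x \<in> B \<Longrightarrow> h x \<in> C x"
  shows "remove_duplicates l \<in> set_codes C B"
proof -
  let ?ds = "to_list (remove_duplicates l)"
  let ?xs = "map (inv_into B h) ?ds"
  have ds: "set ?ds = h ` B" using assms(1) by (metis elements_def elements_remove_duplicates)
  have "distinct ?xs"
    unfolding distinct_map using distinct_remove_duplicates ds by (auto intro: inj_on_inv_into)
  moreover have "set ?xs = B" unfolding set_map ds using assms(2) by (force simp: image_image)
  moreover have "list_all2 (\<lambda>x d. d \<in> C x) ?xs ?ds"
    using ds assms(3) by (auto simp: list_all2_conv_all_nth)
      (metis (no_types, lifting) f_inv_into_f inv_into_into nth_mem)
  ultimately show ?thesis unfolding set_codes_def by (metis (mono_tags, lifting) list_code_to_list mem_Collect_eq)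
qed

section \<open>Generating the coded network\<close>

definition tags :: sexp where
  "tags = Dot Null (Dot (Dot Null Null) Null)"

lemma elements_tags [simp]: "elements tags = range (\<lambda>b. truth b)"
  by (auto simp: tags_def)

definition object_list :: "sexp \<Rightarrow> sexp" where
  "object_list S = concat_map (\<lambda>i. concat_map (\<lambda>s. Dot (Dot i (Dot s Null)) Null) S) tags"

definition customer_list :: "sexp \<Rightarrow> sexp \<Rightarrow> sexp" where
  "customer_list U S = concat_map (\<lambda>i. concat_map (\<lambda>k. concat_map (\<lambda>u. Dot (Dot i (Dot k (Dot u Null))) Null) U) S) tags"

definition middle_tree :: "sexp \<Rightarrow> sexp \<Rightarrow> sexp \<Rightarrow> sexp" where
  "middle_tree i k a = Dot (Dot (Dot Null Null) Null) (Dot i (Dot k a))"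

definition middle_list :: "sexp \<Rightarrow> sexp \<Rightarrow> sexp" where
  "middle_list S K = concat_map (\<lambda>i. concat_map (\<lambda>k. concat_map (\<lambda>a. Dot (middle_tree i k a) Null) K) S) tags"

definition weighted_arc :: "rat \<Rightarrow> sexp \<Rightarrow> sexp \<Rightarrow> sexp" where
  "weighted_arc q x y = Dot x (Dot y (nonneg_rat_code q))"

definition arc_list :: "sexp \<Rightarrow> sexp \<Rightarrow> sexp \<Rightarrow> sexp \<Rightarrow> sexp" where
  "arc_list U S D K =
     append_lists (concat_map (\<lambda>v. Dot (weighted_arc 1 v Null) (Dot (weighted_arc 0 Null v) Null)) (customer_list U S))
    (append_lists (concat_map (\<lambda>v. Dot (weighted_arc 2 v Null) (Dot (weighted_arc 0 Null v) Null)) (object_list S))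
    (append_lists (concat_map (\<lambda>i. concat_map (\<lambda>k. concat_map (\<lambda>a.
         Dot (weighted_arc 0 (Dot i (Dot k (Dot (car a) Null))) (Dot i (Dot (cdr a) Null))) Null) D) S) tags)
    (concat_map (\<lambda>i. concat_map (\<lambda>k. concat_map (\<lambda>a.
         Dot (weighted_arc 0 (Dot i (Dot k (Dot (car a) Null))) (middle_tree i k a))
        (Dot (weighted_arc 0 (middle_tree i k a) (Dot i (Dot (car (cdr a)) Null)))
        (Dot (weighted_arc 0 (middle_tree i k a) (Dot i (Dot (cdr (cdr a)) Null)))
        (Dot (weighted_arc 1 (middle_tree i k a) Null) Null)))) K) S) tags)))"

definition network :: "sexp \<Rightarrow> sexp \<Rightarrow> sexp \<Rightarrow> sexp \<Rightarrow> sexp" where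
  "network U S D K =
     Dot (remove_duplicates (Dot Null (append_lists (object_list S) (append_lists (customer_list U S) (middle_list S K)))))
    (Dot (remove_duplicates (arc_list U S D K))
    (Dot (remove_duplicates (customer_list U S)) (remove_duplicates (append_lists (object_list S) (customer_list U S)))))"

text \<open>The weights 0, 1 and 2 enter as fixed trees, so no arithmetic is programmed. The four
  arguments are packed into one input tree.\<close>

lemma polytime_network: "polytime (\<lambda>x. network (car x) (car (cdr x)) (car (cdr (cdr x))) (cdr (cdr (cdr x))))"
  unfolding network_def arc_list_def object_list_def customer_list_def middle_list_def weighted_arc_def middle_tree_def
  by (intro polytime_intros)

lemma elements_object_list: "elements (object_list S) = object_vertices (elements S)"
  by (auto simp: object_list_def object_vertices_def object_def)

lemma elements_customer_list: "elements (customer_list U S) = customer_vertices (elements U) (elements S)"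
  by (auto simp: customer_list_def customer_vertices_def customer_def)

lemma elements_middle_list: "elements (middle_list S K) = middle_vertices (elements S) (elements K)"
  by (auto simp: middle_list_def middle_vertices_def middle_tree_def middle_def)

text \<open>The rational counterpart of \<open>hub_weight\<close>: codes of arcs store rationals,
  while instances carry real weights.\<close>

definition weight_rat :: "sexp \<times> sexp \<Rightarrow> rat" where
  "weight_rat a = (if snd a = Null then (if \<exists>i s. fst a = object i s then 2 else 1) else 0)"

definition arc_code :: "sexp \<times> sexp \<Rightarrow> sexp" where
  "arc_code a = weighted_arc (weight_rat a) (fst a) (snd a)"

lemma weight_rat_simps [simp]:
  "weight_rat (object i s, Null) = 2" "weight_rat (customer i k u, Null) = 1" "weight_rat (middle i k a, Null) = 1"
  "v \<noteq> Null \<Longrightarrow> weight_rat (x, v) = 0"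
  by (auto simp: weight_rat_def)

lemma arc_code_in_arc_codes: "arc_code a \<in> arc_codes hub_weight a"
  by (auto simp: arc_code_def arc_codes_def weighted_arc_def weight_rat_def hub_weight_def intro!: exI[of _ "weight_rat a"])

lemma inj_arc_code: "inj_on arc_code B"
  by (auto simp: inj_on_def arc_code_def weighted_arc_def)

lemma elements_arc_list:
  "elements (arc_list U S D K) =
     (\<Union>v \<in> customer_vertices (elements U) (elements S). {weighted_arc 1 v Null, weighted_arc 0 Null v}) \<union>
     (\<Union>v \<in> object_vertices (elements S). {weighted_arc 2 v Null, weighted_arc 0 Null v}) \<union>
     (\<Union>i. \<Union>k \<in> elements S. \<Union>a \<in> elements D. {weighted_arc 0 (customer i k (car a)) (object i (cdr a))}) \<union>
     (\<Union>i. \<Union>k \<in> elements S. \<Union>a \<in> elements K. {weighted_arc 0 (customer i k (car a)) (middle i k a),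
        weighted_arc 0 (middle i k a) (object i (car (cdr a))), weighted_arc 0 (middle i k a) (object i (cdr (cdr a))),
        weighted_arc 1 (middle i k a) Null})"
  by (simp only: arc_list_def elements_simps elements_object_list elements_customer_list elements_tags UN_simps(10) Un_assoc)
     (simp only: customer_def object_def middle_def middle_tree_def)

text \<open>The generated entries match the rules of \<open>arc_set\<close> one by one;
  \<open>D_form\<close> and \<open>K_dom\<close> ensure that \<open>car\<close> and
  \<open>cdr\<close> recover the components. Removing repetitions then gives an admissible
  code.\<close>

lemma network_code:
  assumes "hub_network (elements U) (elements S) (elements D) (elements K)"
  shows "network U S D K \<in> dfl_codes (hub_instance (elements U) (elements S) (elements D) (elements K))"
proof -
  interpret hub_network "elements U" "elements S" "elements D" "elements K" by (rule assms)
  have "elements (arc_list U S D K) = arc_code ` A"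
  proof (intro equalityI subsetI)
    fix x assume "x \<in> elements (arc_list U S D K)"
    then consider
      (customer) i k u where "k \<in> elements S" "u \<in> elements U" "x = weighted_arc 1 (customer i k u) Null \<or> x = weighted_arc 0 Null (customer i k u)"
    | (object) i s where "s \<in> elements S" "x = weighted_arc 2 (object i s) Null \<or> x = weighted_arc 0 Null (object i s)"
    | (dir) i k a where "k \<in> elements S" "a \<in> elements D" "x = weighted_arc 0 (customer i k (car a)) (object i (cdr a))"
    | (middle) i k a where "k \<in> elements S" "a \<in> elements K" "x = weighted_arc 0 (customer i k (car a)) (middle i k a) \<or>
        x = weighted_arc 0 (middle i k a) (object i (car (cdr a))) \<or> x = weighted_arc 0 (middle i k a) (object i (cdr (cdr a))) \<or>
        x = weighted_arc 1 (middle i k a) Null"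
      unfolding elements_arc_list customer_vertices_def object_vertices_def by blast
    then show "x \<in> arc_code ` A"
    proof cases
      case customer
      then show ?thesis
        by (elim disjE; intro image_eqI[of _ arc_code "(customer i k u, Null)"] image_eqI[of _ arc_code "(Null, customer i k u)"])
           (auto simp: arc_code_def intro: arc_set.intros)
    next
      case object
      then have "x = arc_code (object i s, Null) \<or> x = arc_code (Null, object i s)" by (simp add: arc_code_def)
      then show ?thesis using object by (auto intro: arc_set.intros)
    next
      case dir
      then obtain u s where "a = Dot u s" using D_form by blast
      with dir have "x = arc_code (customer i k u, object i s)" by (simp add: arc_code_def)
      then show ?thesis using dir \<open>a = Dot u s\<close> by (auto intro: arc_set.intros)
    next
      case middle
      then obtain u s t where a: "a = Dot u (Dot s t)" using K_dom by blast
      with middle(3) have "x = arc_code (customer i k u, middle i k a) \<or> x = arc_code (middle i k a, object i s) \<or>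
          x = arc_code (middle i k a, object i t) \<or> x = arc_code (middle i k a, Null)"
        by (simp add: arc_code_def)
      then show ?thesis using middle(1,2) a by (auto intro: arc_set.intros)
    qed
  next
    fix x assume "x \<in> arc_code ` A"
    then obtain y z where "(y, z) \<in> A" and x: "x = arc_code (y, z)" by auto
    have "arc_code (y, z) \<in> elements (arc_list U S D K)"
      using \<open>(y, z) \<in> A\<close>
    proof cases
      case (customer_hub k u i)
      then show ?thesis unfolding elements_arc_list by (intro UnI1 UN_I[of y]) (auto simp: arc_code_def customer_vertices_def)
    next
      case (hub_customer k u i)
      then show ?thesis unfolding elements_arc_list by (intro UnI1 UN_I[of z]) (auto simp: arc_code_def customer_vertices_def)
    next
      case (object_hub s i)
      then show ?thesis unfolding elements_arc_list by (intro UnI1 UnI2 UN_I[of y]) (auto simp: arc_code_def object_vertices_def)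
    next
      case (hub_object s i)
      then show ?thesis unfolding elements_arc_list by (intro UnI1 UnI2 UN_I[of z]) (auto simp: arc_code_def object_vertices_def)
    next
      case (customer_object k u s i)
      then show ?thesis unfolding elements_arc_list by (intro UnI1 UnI2 UN_I[of i] UN_I[of k] UN_I[of "Dot u s"]) (auto simp: arc_code_def)
    next
      case (customer_middle k u s t i)
      then show ?thesis unfolding elements_arc_list by (intro UnI2 UN_I[of i] UN_I[of k] UN_I[of "Dot u (Dot s t)"]) (auto simp: arc_code_def)
    next
      case (middle_first k u s t i)
      then show ?thesis unfolding elements_arc_list by (intro UnI2 UN_I[of i] UN_I[of k] UN_I[of "Dot u (Dot s t)"]) (auto simp: arc_code_def)
    next
      case (middle_second k u s t i)
      then show ?thesis unfolding elements_arc_list by (intro UnI2 UN_I[of i] UN_I[of k] UN_I[of "Dot u (Dot s t)"]) (auto simp: arc_code_def)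
    next
      case (middle_hub k a i)
      then show ?thesis unfolding elements_arc_list by (intro UnI2 UN_I[of i] UN_I[of k] UN_I[of a]) (auto simp: arc_code_def)
    qed
    with x show "x \<in> elements (arc_list U S D K)" by simp
  qed
  then have "remove_duplicates (arc_list U S D K) \<in> set_codes (arc_codes hub_weight) A"
    using inj_arc_code arc_code_in_arc_codes by (rule remove_duplicates_set_codes)
  then show ?thesis
    unfolding network_def dfl_codes_def
    by (auto simp: set_codes_id elements_object_list elements_customer_list elements_middle_list distinct_remove_duplicates)
qed

section \<open>Choosing the cheaper copy\<close>

definition selected :: "sexp \<Rightarrow> sexp \<Rightarrow> sexp \<Rightarrow> sexp" where
  "selected S e i = concat_map (\<lambda>s. if \<exists>v \<in> elements e. car v = i \<and> car (cdr v) = s then Dot s Null else Null) S"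

definition smaller_selection :: "sexp \<Rightarrow> sexp \<Rightarrow> sexp" where
  "smaller_selection S e = (if length (to_list (selected S e (Dot Null Null))) \<le> length (to_list (selected S e Null))
     then selected S e (Dot Null Null) else selected S e Null)"

lemma polytime_smaller_selection: "polytime (\<lambda>x. smaller_selection (car x) (cdr x))"
  unfolding smaller_selection_def selected_def by (intro polytime_intros)

lemma to_list_concat_map_if: "to_list (concat_map (\<lambda>s. if P s then Dot s Null else Null) S) = filter P (to_list S)"
proof -
  have "concat (map (\<lambda>s. to_list (if P s then Dot s Null else Null)) xs) = filter P xs" for xs
    by (induction xs) auto
  then show ?thesis by (simp add: concat_map_def)
qed

text \<open>By \<open>card_picked\<close> the two selections together are no larger than the
  facility cover, so the smaller one has at most half its size. Filtering \<open>S\<close> keeps the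
  entries distinct.\<close>

lemma smaller_selection_picked:
  assumes "distinct (to_list S)" "finite (elements e)"
  obtains i where "elements (smaller_selection S e) = picked (elements S) i (elements e)" "distinct (to_list (smaller_selection S e))"
    "2 * card (elements (smaller_selection S e)) \<le> card (elements e)"
proof -
  have dist: "distinct (to_list (selected S e i))" for i
    using assms(1) by (simp add: selected_def to_list_concat_map_if)
  have elements: "elements (selected S e (truth i)) = picked (elements S) i (elements e)" for i
    by (auto simp: elements_def selected_def to_list_concat_map_if picked_def)
  have len: "length (to_list (selected S e (truth i))) = card (picked (elements S) i (elements e))" for i
    using distinct_card[OF dist] elements unfolding elements_def by metis
  have sum: "card (picked (elements S) True (elements e)) + card (picked (elements S) False (elements e)) \<le> card (elements e)"
    using assms(2) by (rule card_picked)
  show thesis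
  proof (cases "length (to_list (selected S e (truth True))) \<le> length (to_list (selected S e (truth False)))")
    case True
    then have "smaller_selection S e = selected S e (truth True)" by (simp add: smaller_selection_def)
    with that[of True] dist[of "truth True"] elements[of True] sum True len[of True] len[of False] show thesis by simp
  next
    case False
    then have "smaller_selection S e = selected S e (truth False)" by (simp add: smaller_selection_def)
    with that[of False] dist[of "truth False"] elements[of False] sum False len[of True] len[of False] show thesis by simp
  qed
qed

text \<open>Optima at most double on the way to \<open>A\<close>, and costs at least halve on the
  way back. The two factors cancel, so each ratio carries over exactly.\<close>

lemma reductionI:
  assumes "polytime f" "polytime g"
    and red: "\<And>I d. I \<in> instances B \<Longrightarrow> d \<in> instance_codes B I \<Longrightarrow> solutions B I \<noteq> {} \<Longrightarrow>
      \<exists>J \<in> instances A. f d \<in> instance_codes A J \<and>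
        (\<forall>x \<in> solutions B I. \<exists>y \<in> solutions A J. cost A y \<le> 2 * cost B x) \<and>
        (\<forall>y \<in> solutions A J. \<forall>e \<in> solution_codes A y.
           \<exists>x \<in> solutions B I. g (Dot d e) \<in> solution_codes B x \<and> 2 * cost B x \<le> cost A y)"
  shows "at_least_as_hard_to_approximate A B"
  unfolding at_least_as_hard_to_approximate_def
proof (intro exI conjI ballI impI)
  fix I d assume I: "I \<in> instances B" "d \<in> instance_codes B I" "solutions B I \<noteq> {}"
  from red[OF I] obtain J where J: "J \<in> instances A" "f d \<in> instance_codes A J"
    and lift: "\<And>x. x \<in> solutions B I \<Longrightarrow> \<exists>y \<in> solutions A J. cost A y \<le> 2 * cost B x"
    and pull: "\<And>y e. y \<in> solutions A J \<Longrightarrow> e \<in> solution_codes A y \<Longrightarrow>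
      \<exists>x \<in> solutions B I. g (Dot d e) \<in> solution_codes B x \<and> 2 * cost B x \<le> cost A y"
    by blast
  \<comment> \<open>The infimum of a nonempty set of natural numbers is attained, so an optimal
    solution exists.\<close>
  have "cost B ` solutions B I \<noteq> {}" using I(3) by blast
  then have "optimum B I \<in> cost B ` solutions B I"
    unfolding optimum_def by (rule Inf_nat_def1)
  then obtain x0 where x0: "x0 \<in> solutions B I" "cost B x0 = optimum B I" by auto
  obtain y0 where y0: "y0 \<in> solutions A J" "cost A y0 \<le> 2 * cost B x0" using lift[OF x0(1)] by blast
  have "optimum A J \<le> cost A y0"
    unfolding optimum_def using y0(1) by (intro cInf_lower) auto
  with y0(2) x0(2) have opt: "optimum A J \<le> 2 * optimum B I" by simp
  show "\<exists>J \<in> instances A. f d \<in> instance_codes A J \<and> solutions A J \<noteq> {} \<and>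
      (\<forall>y \<in> solutions A J. \<forall>e \<in> solution_codes A y. \<exists>x \<in> solutions B I. g (Dot d e) \<in> solution_codes B x \<and>
        (\<forall>r \<ge> 1. approximates A r J y \<longrightarrow> approximates B r I x))"
  proof (intro bexI[of _ J] conjI ballI)
    fix y e assume y: "y \<in> solutions A J" "e \<in> solution_codes A y"
    from pull[OF y] obtain x where x: "x \<in> solutions B I" "g (Dot d e) \<in> solution_codes B x"
      "2 * cost B x \<le> cost A y" by blast
    have "approximates B r I x" if "1 \<le> r" "approximates A r J y" for r
    proof -
      have "2 * real (cost B x) \<le> real (cost A y)" using x(3) by linarith
      also have "\<dots> \<le> r * real (optimum A J)" using that(2) by (simp add: approximates_def)
      also have "\<dots> \<le> r * (2 * real (optimum B I))"
        using that(1) opt by (intro mult_left_mono) linarith+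
      finally show ?thesis using x(1) by (simp add: approximates_def)
    qed
    with x(1,2) show "\<exists>x \<in> solutions B I. g (Dot d e) \<in> solution_codes B x \<and>
        (\<forall>r \<ge> 1. approximates A r J y \<longrightarrow> approximates B r I x)" by blast
  qed (use J y0 in auto)
qed (use assms(1,2) in auto)

section \<open>The two instance maps\<close>

definition scp_direct :: "sexp \<Rightarrow> sexp \<Rightarrow> sexp \<Rightarrow> sexp" where
  "scp_direct U S T = concat_map (\<lambda>u. concat_map (\<lambda>s. if Dot u (Dot s s) \<in> elements T then Dot (Dot u s) Null else Null) S) U"

text \<open>The triples need not be symmetric and may use an object twice, so \<open>s\<close> and
  \<open>t\<close> conflict only if none of the four triples formed from them is present.\<close>

definition scp_conflict :: "sexp \<Rightarrow> sexp \<Rightarrow> sexp \<Rightarrow> sexp" where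
  "scp_conflict U S T = concat_map (\<lambda>u. concat_map (\<lambda>s. concat_map (\<lambda>t.
     if Dot u (Dot s s) \<notin> elements T \<and> Dot u (Dot t t) \<notin> elements T \<and> Dot u (Dot s t) \<notin> elements T \<and> Dot u (Dot t s) \<notin> elements T
     then Dot (Dot u (Dot s t)) Null else Null) S) S) U"

definition sc_direct :: "sexp \<Rightarrow> sexp \<Rightarrow> sexp" where
  "sc_direct U S = concat_map (\<lambda>u. concat_map (\<lambda>s. if u \<in> elements s then Dot (Dot u s) Null else Null) S) U"

definition scp_to_sdfl :: "sexp \<Rightarrow> sexp" where
  "scp_to_sdfl d = network (car d) (car (cdr d)) (scp_direct (car d) (car (cdr d)) (cdr (cdr d)))
     (scp_conflict (car d) (car (cdr d)) (cdr (cdr d)))"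

definition sc_to_pdfl :: "sexp \<Rightarrow> sexp" where
  "sc_to_pdfl d = network (car d) (cdr d) (sc_direct (car d) (cdr d)) Null"

lemma polytime_scp_to_sdfl: "polytime scp_to_sdfl"
proof -
  have "polytime (\<lambda>d. Dot (car d) (Dot (car (cdr d)) (Dot (scp_direct (car d) (car (cdr d)) (cdr (cdr d)))
     (scp_conflict (car d) (car (cdr d)) (cdr (cdr d))))))"
    unfolding scp_direct_def scp_conflict_def by (intro polytime_intros)
  from polytime_comp[OF this polytime_network] show ?thesis
    by (simp add: scp_to_sdfl_def[abs_def])
qed

lemma polytime_sc_to_pdfl: "polytime sc_to_pdfl"
proof -
  have "polytime (\<lambda>d. Dot (car d) (Dot (cdr d) (Dot (sc_direct (car d) (cdr d)) Null)))"
    unfolding sc_direct_def by (intro polytime_intros)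
  from polytime_comp[OF this polytime_network] show ?thesis
    by (simp add: sc_to_pdfl_def[abs_def])
qed

lemma elements_if: "elements (if P then d else Null) = (if P then elements d else {})"
  by simp

lemma elements_scp_direct:
  "elements (scp_direct U S T) = {Dot u s | u s. u \<in> elements U \<and> s \<in> elements S \<and> Dot u (Dot s s) \<in> elements T}"
  unfolding scp_direct_def by (auto simp: elements_if split: if_splits)

lemma elements_scp_conflict:
  "elements (scp_conflict U S T) = {Dot u (Dot s t) | u s t. u \<in> elements U \<and> s \<in> elements S \<and> t \<in> elements S \<and>
     Dot u (Dot s s) \<notin> elements T \<and> Dot u (Dot t t) \<notin> elements T \<and> Dot u (Dot s t) \<notin> elements T \<and> Dot u (Dot t s) \<notin> elements T}"
  unfolding scp_conflict_def by (auto simp: elements_if split: if_splits)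

lemma elements_sc_direct:
  "elements (sc_direct U S) = {Dot u s | u s. u \<in> elements U \<and> s \<in> elements S \<and> u \<in> elements s}"
  unfolding sc_direct_def by (auto simp: elements_if split: if_splits)

section \<open>The two reductions\<close>

theorem SDFL_at_least_as_hard_as_SCP: "at_least_as_hard_to_approximate SDFL SCP"
proof (rule reductionI)
  show "polytime scp_to_sdfl" by (rule polytime_scp_to_sdfl)
  \<comment> \<open>On \<open>Dot d e\<close>, the back map reads the list of objects from
    \<open>d\<close> and the facility cover from \<open>e\<close>.\<close>
  show "polytime (\<lambda>x. smaller_selection (car (cdr (car x))) (cdr x))"
    using polytime_comp[OF polytime_pair[OF polytime_car[OF polytime_cdr[OF polytime_car[OF polytime_id]]]
        polytime_cdr[OF polytime_id]] polytime_smaller_selection] by simp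
next
  fix I d assume I: "I \<in> instances SCP" "d \<in> instance_codes SCP I" "solutions SCP I \<noteq> {}"
  obtain U S T where d: "d = Dot U (Dot S T)"
    and U: "elements U = scp_ground I" and S: "elements S = scp_objects I" "distinct (to_list S)"
    and T: "T \<in> set_codes triple_codes (scp_triples I)"
    using I(2) by (auto simp: SCP_def scp_codes_def set_codes_id)
  have "triple_codes = (\<lambda>x. {case x of (u, s, t) \<Rightarrow> Dot u (Dot s t)})"
    by (auto simp: triple_codes_def fun_eq_iff)
  then have "T \<in> set_codes (\<lambda>x. {case x of (u, s, t) \<Rightarrow> Dot u (Dot s t)}) (scp_triples I)"
    using T by (simp only:)
  then have "elements T = (\<lambda>(u, s, t). Dot u (Dot s t)) ` scp_triples I"
    unfolding set_codes_singleton elements_def by (elim exE conjE) simp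
  then have T: "Dot u (Dot s t) \<in> elements T \<longleftrightarrow> (u, s, t) \<in> scp_triples I" for u s t
    by force
  have triples: "scp_triples I \<subseteq> elements U \<times> elements S \<times> elements S"
    using I(1) U S by (auto simp: SCP_def scp_valid_def)
  let ?D = "scp_direct U S T" and ?K = "scp_conflict U S T"
  interpret hub_network "elements U" "elements S" "elements ?D" "elements ?K"
    by unfold_locales (rule finite_elements | auto simp: elements_scp_direct elements_scp_conflict)+
  have conflict: "Dot u (Dot s t) \<notin> elements ?K \<longleftrightarrow> (u, s, s) \<in> scp_triples I \<or> (u, t, t) \<in> scp_triples I \<or>
      (u, s, t) \<in> scp_triples I \<or> (u, t, s) \<in> scp_triples I"
    if "u \<in> elements U" "s \<in> elements S" "t \<in> elements S" for u s t
    using that by (auto simp: elements_scp_conflict T)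
  \<comment> \<open>Each of the four triples that prevent a conflict uses only objects of
    \<open>X\<close>, so it is itself a witness.\<close>
  have cover: "(\<exists>s \<in> X. \<exists>t \<in> X. Dot u (Dot s t) \<notin> elements ?K) \<longleftrightarrow> (\<exists>s \<in> X. \<exists>t \<in> X. (u, s, t) \<in> scp_triples I)"
    if "X \<subseteq> elements S" "u \<in> elements U" for X u
    using conflict that by (meson subsetD)
  interpret conflict_network "elements U" "elements S" "elements ?D" "elements ?K"
    by unfold_locales (auto simp: elements_scp_direct elements_scp_conflict)
  have sol: "X \<in> solutions SCP I \<longleftrightarrow> X \<subseteq> elements S \<and> (\<forall>u \<in> elements U. \<exists>s \<in> X. \<exists>t \<in> X. Dot u (Dot s t) \<notin> elements ?K)" for X
    using cover unfolding SCP_def scp_cover_def U S by auto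
  show "\<exists>J \<in> instances SDFL. scp_to_sdfl d \<in> instance_codes SDFL J \<and>
      (\<forall>x \<in> solutions SCP I. \<exists>y \<in> solutions SDFL J. cost SDFL y \<le> 2 * cost SCP x) \<and>
      (\<forall>y \<in> solutions SDFL J. \<forall>e \<in> solution_codes SDFL y. \<exists>x \<in> solutions SCP I.
         smaller_selection (car (cdr (car (Dot d e)))) (cdr (Dot d e)) \<in> solution_codes SCP x \<and> 2 * cost SCP x \<le> cost SDFL y)"
  proof (intro bexI[of _ J] conjI ballI)
    show "J \<in> instances SDFL" using dfl_valid_J by (simp add: SDFL_def)
    show "scp_to_sdfl d \<in> instance_codes SDFL J"
      using network_code[OF hub_network_axioms] by (simp add: SDFL_def scp_to_sdfl_def d)
  next
    fix X assume X: "X \<in> solutions SCP I"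
    then have "object_vertices X \<in> solutions SDFL J" using setwise_lift[of X] by (auto simp: sol SDFL_def)
    moreover have "finite X" using X finite_elements finite_subset unfolding sol by blast
    ultimately show "\<exists>y \<in> solutions SDFL J. cost SDFL y \<le> 2 * cost SCP X"
      by (intro bexI[of _ "object_vertices X"]) (simp_all add: SDFL_def SCP_def card_object_vertices)
  next
    fix y e assume y: "y \<in> solutions SDFL J" "e \<in> solution_codes SDFL y"
    then have cov: "setwise_disjoint_cover J y" and e: "elements e = y"
      by (auto simp: SDFL_def set_codes_id)
    obtain i where i: "elements (smaller_selection S e) = picked (elements S) i y" "distinct (to_list (smaller_selection S e))"
      "2 * card (elements (smaller_selection S e)) \<le> card y"
      using smaller_selection_picked[OF S(2) finite_elements, of e] e by metis
    \<comment> \<open>Solvability shows that all objects together cover each \<open>u\<close>, as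
      the case in which every customer for \<open>u\<close> is chosen requires.\<close>
    obtain X where X: "X \<subseteq> elements S" "\<forall>u \<in> elements U. \<exists>s \<in> X. \<exists>t \<in> X. Dot u (Dot s t) \<notin> elements ?K"
      using I(3) sol by blast
    have "\<exists>s \<in> elements S. \<exists>t \<in> elements S. Dot u (Dot s t) \<notin> elements ?K" if "u \<in> elements U" for u
      using X that by blast
    then have "elements (smaller_selection S e) \<in> solutions SCP I"
      unfolding sol i(1) using setwise_picked[OF cov] by (auto simp: picked_def)
    then show "\<exists>x \<in> solutions SCP I. smaller_selection (car (cdr (car (Dot d e)))) (cdr (Dot d e)) \<in> solution_codes SCP x \<and>
        2 * cost SCP x \<le> cost SDFL y"
      using i by (intro bexI[of _ "elements (smaller_selection S e)"]) (auto simp: SCP_def SDFL_def set_codes_id d)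
  qed
qed

theorem PDFL_at_least_as_hard_as_Set_Cover: "at_least_as_hard_to_approximate PDFL Set_Cover"
proof (rule reductionI)
  show "polytime sc_to_pdfl" by (rule polytime_sc_to_pdfl)
  show "polytime (\<lambda>x. smaller_selection (cdr (car x)) (cdr x))"
    using polytime_comp[OF polytime_pair[OF polytime_cdr[OF polytime_car[OF polytime_id]]
        polytime_cdr[OF polytime_id]] polytime_smaller_selection] by simp
next
  fix I d assume I: "I \<in> instances Set_Cover" "d \<in> instance_codes Set_Cover I" "solutions Set_Cover I \<noteq> {}"
  obtain U S where d: "d = Dot U S" and U: "elements U = sc_ground I"
    and S: "S \<in> set_codes (set_codes id_codes) (sc_sets I)"
    using I(2) by (auto simp: Set_Cover_def sc_codes_def set_codes_id)
  obtain ds xs where ds: "S = list_code ds" "distinct xs" "set xs = sc_sets I"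
    "list_all2 (\<lambda>x d. d \<in> set_codes id_codes x) xs ds"
    using S unfolding set_codes_def[of "set_codes id_codes"] by blast
  have xs: "xs = map elements ds"
    using ds(4) by (auto simp: set_codes_id list_all2_conv_all_nth intro: nth_equalityI)
  have code: "distinct (to_list s)" if "s \<in> elements S" for s
    using ds(1,4) that by (auto simp: set_codes_id list_all2_conv_all_nth in_set_conv_nth)
  \<comment> \<open>The listed codes serve as cover objects. Each set of the collection has one code
    in \<open>S\<close>, so numbers of codes and numbers of sets agree.\<close>
  have dist: "distinct (to_list S)" and inj: "inj_on elements (elements S)" and sets: "elements ` elements S = sc_sets I"
    using ds xs by (auto simp: distinct_map)
  have ground: "\<Union> (elements ` elements S) = elements U" using I(1) U sets by (simp add: Set_Cover_def sc_valid_def)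
  let ?D = "sc_direct U S"
  \<comment> \<open>In Set Cover each element is covered by a single set, so there are no conflicts
    and no middle vertices.\<close>
  interpret hub_network "elements U" "elements S" "elements ?D" "elements Null"
    by unfold_locales (rule finite_elements | auto simp: elements_sc_direct)+
  have direct: "Dot u s \<in> elements ?D \<longleftrightarrow> u \<in> elements s" if "u \<in> elements U" "s \<in> elements S" for u s
    using that by (auto simp: elements_sc_direct)
  have cover: "elements ` X \<in> solutions Set_Cover I \<longleftrightarrow> (\<forall>u \<in> elements U. \<exists>s \<in> X. Dot u s \<in> elements ?D)"
    if "X \<subseteq> elements S" for X
  proof -
    have "elements ` X \<in> solutions Set_Cover I \<longleftrightarrow> \<Union> (elements ` X) = elements U"
      using that sets by (auto simp: Set_Cover_def sc_cover_def U)
    also have "\<dots> \<longleftrightarrow> elements U \<subseteq> \<Union> (elements ` X)" using that ground by blast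
    also have "\<dots> \<longleftrightarrow> (\<forall>u \<in> elements U. \<exists>s \<in> X. Dot u s \<in> elements ?D)"
      using direct that by (simp add: subset_iff Bex_def) (metis in_mono that)
    finally show ?thesis .
  qed
  show "\<exists>J \<in> instances PDFL. sc_to_pdfl d \<in> instance_codes PDFL J \<and>
      (\<forall>x \<in> solutions Set_Cover I. \<exists>y \<in> solutions PDFL J. cost PDFL y \<le> 2 * cost Set_Cover x) \<and>
      (\<forall>y \<in> solutions PDFL J. \<forall>e \<in> solution_codes PDFL y. \<exists>x \<in> solutions Set_Cover I.
         smaller_selection (cdr (car (Dot d e))) (cdr (Dot d e)) \<in> solution_codes Set_Cover x \<and>
         2 * cost Set_Cover x \<le> cost PDFL y)"
  proof (intro bexI[of _ J] conjI ballI)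
    show "J \<in> instances PDFL" using dfl_valid_J by (simp add: PDFL_def)
    show "sc_to_pdfl d \<in> instance_codes PDFL J"
      using network_code[OF hub_network_axioms] by (simp add: PDFL_def sc_to_pdfl_def d)
  next
    fix Y assume Y: "Y \<in> solutions Set_Cover I"
    then have "Y \<subseteq> elements ` elements S" by (auto simp: sets Set_Cover_def sc_cover_def)
    then obtain X where X: "X \<subseteq> elements S" "Y = elements ` X" by (auto simp: subset_image_iff)
    then have "\<forall>u \<in> elements U. \<exists>s \<in> X. Dot u s \<in> elements ?D" using cover Y by blast
    then have "object_vertices X \<in> solutions PDFL J" using pathwise_lift[of X] X(1) by (simp add: PDFL_def)
    moreover have "finite X" using X(1) finite_elements finite_subset by blast
    moreover have "card Y = card X" unfolding X(2) using inj X(1) by (meson card_image inj_on_subset)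
    ultimately show "\<exists>y \<in> solutions PDFL J. cost PDFL y \<le> 2 * cost Set_Cover Y"
      by (intro bexI[of _ "object_vertices X"]) (simp_all add: PDFL_def Set_Cover_def card_object_vertices)
  next
    fix y e assume y: "y \<in> solutions PDFL J" "e \<in> solution_codes PDFL y"
    then have cov: "pathwise_disjoint_cover J y" and e: "elements e = y"
      by (auto simp: PDFL_def set_codes_id)
    obtain i where i: "elements (smaller_selection S e) = picked (elements S) i y" "distinct (to_list (smaller_selection S e))"
      "2 * card (elements (smaller_selection S e)) \<le> card y"
      using smaller_selection_picked[OF dist finite_elements, of e] e by metis
    let ?X = "elements (smaller_selection S e)"
    have X: "?X \<subseteq> elements S" unfolding i(1) by (auto simp: picked_def)
    \<comment> \<open>The union of the whole collection is the ground set, so some set contains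
      \<open>u\<close>.\<close>
    have "\<exists>s \<in> elements S. Dot u s \<in> elements ?D" if "u \<in> elements U" for u
      using that ground direct by blast
    then have "\<forall>u \<in> elements U. \<exists>s \<in> ?X. Dot u s \<in> elements ?D"
      unfolding i(1) using pathwise_picked[OF _ cov] by simp
    then have sol: "elements ` ?X \<in> solutions Set_Cover I" using cover[OF X] by blast
    have injX: "inj_on elements ?X" using inj X by (rule inj_on_subset)
    \<comment> \<open>The selected entries are the original codes of their sets, so they already
      form a code of the subcollection.\<close>
    have "smaller_selection S e \<in> set_codes (set_codes id_codes) (elements ` ?X)"
      unfolding set_codes_def[of "set_codes id_codes"]
    proof (intro CollectI exI conjI)
      show "smaller_selection S e = list_code (to_list (smaller_selection S e))" by simp
      show "distinct (map elements (to_list (smaller_selection S e)))"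
        using i(2) injX by (simp add: distinct_map elements_def)
      show "list_all2 (\<lambda>x d. d \<in> set_codes id_codes x) (map elements (to_list (smaller_selection S e))) (to_list (smaller_selection S e))"
        unfolding list.rel_map
        by (rule list.rel_refl_strong) (use X code in \<open>auto simp: set_codes_id elements_def\<close>)
    qed (simp add: elements_def)
    moreover have "card (elements ` ?X) = card ?X" using injX by (rule card_image)
    ultimately show "\<exists>x \<in> solutions Set_Cover I.
        smaller_selection (cdr (car (Dot d e))) (cdr (Dot d e)) \<in> solution_codes Set_Cover x \<and>
        2 * cost Set_Cover x \<le> cost PDFL y"
      using i(3) sol by (intro bexI[of _ "elements ` ?X"]) (simp_all add: Set_Cover_def PDFL_def d)
  qed
qed

theorem theorem2:
  shows "at_least_as_hard_to_approximate SDFL SCP \<and>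
         at_least_as_hard_to_approximate PDFL Set_Cover"
  using SDFL_at_least_as_hard_as_SCP PDFL_at_least_as_hard_as_Set_Cover by (rule conjI)

end
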